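(* Let $V\in C^3(\mathbb R_{>0}^d)$ be such that $\mu(d\mathbf x)\propto e^{-V(\mathbf x)}\,d\mathbf x$ is a probability measure on $\mathbb R_{>0}^d$, and assume that the Laguerre SDE $$dX_{t,i}=\big(1-X_{t,i}\,\partial_iV(\mathbf X_t)\big)\,dt+\sqrt{2X_{t,i}}\,dB_{t,i},\qquad i=1,\dots,d,$$ ($\mathbf B$ a standard $d$-dimensional Brownian motion) is well defined and non-explosive on $\mathbb R_{>0}^d$. (i) If $\kappa>0$ and $\mu$ is $\kappa$-Laguerre-ULC, then $$\kappa\,\mathrm{Var}_\mu[f]\le\mathbf E_{\mathbf x\sim\mu}\Big[\sum_{i=1}^dx_i\big(\partial_if(\mathbf x)\big)^2\Big]\qquad\text{for all }f\in C_c^\infty(\mathbb R_{>0}^d).$$ (ii) More generally, if the matrix $\mathbf K_{\mathbf x}$ is positive definite for every $\mathbf x\in\mathbb R_{>0}^d$, then $$\mathrm{Var}_\mu[f]\le\mathbf E_{\mathbf x\sim\mu}\big[\nabla f(\mathbf x)^\top\,\mathbf K_{\mathbf x}^{-1}\,\nabla f(\mathbf x)\big]\qquad\text{for all }f\in C_c^\infty(\mathbb R_{>0}^d).$$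
   Context: $\mathbb R_{>0}^d$ is the open positive orthant and $C_c^\infty(\mathbb R_{>0}^d)$ the smooth functions with compact support in it. The local curvature matrix in the Laguerre setting is $$\mathbf K_{\mathbf x}=\nabla^2V(\mathbf x)+\mathrm{diag}\Big(\frac{\partial_iV(\mathbf x)}{x_i}\Big)_{i=1}^d .$$ $\mu$ is $\kappa$-Laguerre-ULC ($\kappa>0$) if $\mathbf K_{\mathbf x}\succeq\kappa\,\mathrm{diag}(1/x_i)_{i=1}^d$ (positive semidefinite order) for every $\mathbf x\in\mathbb R_{>0}^d$. *)

theory Defs
  imports "HOL-Probability.Probability"
begin

definition orthant :: "(real ^ 'n) set" where
  "orthant = {x. \<forall>i. 0 < x $ i}"

definition partial :: "'n \<Rightarrow> (real ^ 'n \<Rightarrow> real) \<Rightarrow> real ^ 'n \<Rightarrow> real" where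
  "partial i f x = frechet_derivative f (at x) (axis i 1)"

definition grad :: "(real ^ 'n \<Rightarrow> real) \<Rightarrow> real ^ 'n \<Rightarrow> real ^ 'n" where
  "grad f x = (\<chi> i. partial i f x)"

definition hess :: "(real ^ 'n \<Rightarrow> real) \<Rightarrow> real ^ 'n \<Rightarrow> real ^ 'n ^ 'n" where
  "hess f x = (\<chi> i j. partial i (partial j f) x)"

text \<open>
  \<open>Ck_on k S f\<close> is \<open>f \<in> C\<^sup>k(S)\<close>; it is meant for open \<open>S\<close> only, since the derivatives
  are taken in the ambient space. Values of \<open>f\<close> outside \<open>S\<close> are irrelevant.
\<close>
fun Ck_on :: "nat \<Rightarrow> (real ^ 'n) set \<Rightarrow> (real ^ 'n \<Rightarrow> real) \<Rightarrow> bool" where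
  "Ck_on 0 S f \<longleftrightarrow> continuous_on S f"
| "Ck_on (Suc k) S f \<longleftrightarrow>
     (\<forall>x\<in>S. f differentiable (at x)) \<and> (\<forall>i. Ck_on k S (partial i f))"

definition test_function :: "(real ^ 'n \<Rightarrow> real) \<Rightarrow> bool" where
  "test_function f \<longleftrightarrow>
     (\<forall>k. Ck_on k orthant f) \<and>
     (\<exists>C. compact C \<and> C \<subseteq> orthant \<and> (\<forall>x\<in>orthant - C. f x = 0))"

text \<open>
  If \<open>exp (- V)\<close> is not integrable, the normalising integral is \<open>0\<close> by convention and the
  measure below is the null measure. Hence \<open>prob_space (gibbs V)\<close> says exactly that
  \<open>exp (- V)\<close> can be normalised to a probability density on the orthant.
\<close>
definition gibbs :: "(real ^ 'n \<Rightarrow> real) \<Rightarrow> (real ^ 'n) measure" where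
  "gibbs V =
     density (restrict_space lborel orthant)
       (\<lambda>x. ennreal (exp (- V x) / (\<integral>y. exp (- V y) \<partial>restrict_space lborel orthant)))"

definition diag_mat :: "real ^ 'n \<Rightarrow> real ^ 'n ^ 'n" where
  "diag_mat v = (\<chi> i j. if i = j then v $ i else 0)"

definition pos_semidef :: "real ^ 'n ^ 'n \<Rightarrow> bool" where
  "pos_semidef A \<longleftrightarrow> transpose A = A \<and> (\<forall>v. 0 \<le> v \<bullet> (A *v v))"

definition pos_def :: "real ^ 'n ^ 'n \<Rightarrow> bool" where
  "pos_def A \<longleftrightarrow> transpose A = A \<and> (\<forall>v. v \<noteq> 0 \<longrightarrow> 0 < v \<bullet> (A *v v))"

definition curvature :: "(real ^ 'n \<Rightarrow> real) \<Rightarrow> real ^ 'n \<Rightarrow> real ^ 'n ^ 'n" where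
  "curvature V x = hess V x + diag_mat (\<chi> i. partial i V x / x $ i)"

definition laguerre_ulc :: "real \<Rightarrow> (real ^ 'n \<Rightarrow> real) \<Rightarrow> bool" where
  "laguerre_ulc \<kappa> V \<longleftrightarrow>
     0 < \<kappa> \<and> (\<forall>x\<in>orthant. pos_semidef (curvature V x - \<kappa> *\<^sub>R diag_mat (\<chi> i. 1 / x $ i)))"

text \<open>
  Time runs over \<open>[0, \<infinity>)\<close>; processes and filtrations are indexed by \<open>real\<close>, and their values
  at negative times play no role. No usual conditions are imposed on the filtration.
\<close>
definition filtered_prob_space :: "'w measure \<Rightarrow> (real \<Rightarrow> 'w measure) \<Rightarrow> bool" where
  "filtered_prob_space M F \<longleftrightarrow>
     prob_space M \<and> filtration (space M) F \<and> (\<forall>t. subalgebra M (F t))"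

definition std_brownian_motion ::
  "'w measure \<Rightarrow> (real \<Rightarrow> 'w measure) \<Rightarrow> (real \<Rightarrow> 'w \<Rightarrow> real ^ 'n) \<Rightarrow> bool" where
  "std_brownian_motion M F B \<longleftrightarrow>
     (\<forall>t\<ge>0. B t \<in> borel_measurable (F t)) \<and>
     (AE \<omega> in M. B 0 \<omega> = 0) \<and>
     (AE \<omega> in M. continuous_on {0..} (\<lambda>t. B t \<omega>)) \<and>
     (\<forall>s t. 0 \<le> s \<longrightarrow> s < t \<longrightarrow>
        prob_space.indep_set M (sets (F s))
          (sets (vimage_algebra (space M) (\<lambda>\<omega>. B t \<omega> - B s \<omega>) borel)) \<and>
        prob_space.indep_vars M (\<lambda>_. borel) (\<lambda>i \<omega>. (B t \<omega> - B s \<omega>) $ i) UNIV \<and>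
        (\<forall>i. distributed M lborel (\<lambda>\<omega>. (B t \<omega> - B s \<omega>) $ i) (normal_density 0 (sqrt (t - s)))))"

text \<open>
  \<open>ito_integral M H b t J\<close> says that \<open>J\<close> is (a version of) the Ito integral
  \<open>\<integral>\<^sub>0\<^sup>t H\<^sub>s db\<^sub>s\<close>, defined as the limit in probability of the left-endpoint Riemann sums over
  partitions \<open>0 = p\<^sub>0 \<le> \<dots> \<le> p\<^sub>n = t\<close> whose mesh tends to \<open>0\<close>. This is the
  Ito integral for adapted integrands with continuous paths, the only ones used here.
\<close>
definition ito_integral ::
  "'w measure \<Rightarrow> (real \<Rightarrow> 'w \<Rightarrow> real) \<Rightarrow> (real \<Rightarrow> 'w \<Rightarrow> real) \<Rightarrow> real \<Rightarrow> ('w \<Rightarrow> real) \<Rightarrow> bool" where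
  "ito_integral M H b t J \<longleftrightarrow>
     J \<in> borel_measurable M \<and>
     (\<forall>\<epsilon>>0. \<forall>\<eta>>0. \<exists>\<delta>>0. \<forall>(n::nat) p.
        p 0 = 0 \<and> p n = t \<and> (\<forall>k<n. p k \<le> p (Suc k) \<and> p (Suc k) - p k < \<delta>) \<longrightarrow>
        measure M {\<omega>\<in>space M.
          \<epsilon> < \<bar>(\<Sum>k<n. H (p k) \<omega> * (b (p (Suc k)) \<omega> - b (p k) \<omega>)) - J \<omega>\<bar>} < \<eta>)"

text \<open>A solution is required to exist for all times and never to leave the open orthant.\<close>
definition laguerre_solution ::
  "(real ^ 'n \<Rightarrow> real) \<Rightarrow> 'w measure \<Rightarrow> (real \<Rightarrow> 'w measure) \<Rightarrow> (real \<Rightarrow> 'w \<Rightarrow> real ^ 'n) \<Rightarrow>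
   real ^ 'n \<Rightarrow> (real \<Rightarrow> 'w \<Rightarrow> real ^ 'n) \<Rightarrow> bool" where
  "laguerre_solution V M F B x X \<longleftrightarrow>
     (\<forall>t\<ge>0. X t \<in> borel_measurable (F t)) \<and>
     (AE \<omega> in M. continuous_on {0..} (\<lambda>t. X t \<omega>) \<and> (\<forall>t\<ge>0. X t \<omega> \<in> orthant)) \<and>
     (\<forall>t\<ge>0. \<forall>i. \<exists>J.
        ito_integral M (\<lambda>s \<omega>. sqrt (2 * X s \<omega> $ i)) (\<lambda>s \<omega>. B s \<omega> $ i) t J \<and>
        (AE \<omega> in M.
           X t \<omega> $ i = x $ i + (LBINT s:{0..t}. 1 - X s \<omega> $ i * partial i V (X s \<omega>)) + J \<omega>))"

text \<open>
  Well defined and non-explosive: from every starting point in the orthant there is a solution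
  that is global in time and stays in the orthant, and it is unique up to indistinguishability.
\<close>
definition laguerre_well_posed ::
  "(real ^ 'n \<Rightarrow> real) \<Rightarrow> 'w measure \<Rightarrow> (real \<Rightarrow> 'w measure) \<Rightarrow> (real \<Rightarrow> 'w \<Rightarrow> real ^ 'n) \<Rightarrow> bool" where
  "laguerre_well_posed V M F B \<longleftrightarrow>
     (\<forall>x\<in>orthant.
        (\<exists>X. laguerre_solution V M F B x X) \<and>
        (\<forall>X Y. laguerre_solution V M F B x X \<longrightarrow> laguerre_solution V M F B x Y \<longrightarrow>
           (AE \<omega> in M. \<forall>t\<ge>0. X t \<omega> = Y t \<omega>)))"

end

theory Submission
  imports Defs
begin

text \<open>
  In the coordinates \<open>x = exp z\<close> the measure becomes \<open>exp (- W)\<close> on the whole space with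
  \<open>W z = V (exp z) - (\<Sum>i. z $ i)\<close>, and the Hessian of \<open>W\<close> is \<open>D ** K x ** D\<close> with \<open>D = diag x\<close>.
  Part (ii) is therefore the Brascamp--Lieb inequality for the strictly convex potential \<open>W\<close>,
  and part (i) follows because \<open>K x\<close> dominates \<open>\<kappa> diag (1 / x)\<close>.

  Brascamp--Lieb is obtained from the midpoint Prekopa--Leindler inequality, applied to
  \<open>exp (\<epsilon> f - V)\<close>, \<open>exp (- \<epsilon> f - V)\<close> and \<open>exp (\<epsilon>\<^sup>2 / 2 * (Q + \<eta>) - V)\<close> with
  \<open>Q = \<nabla>f \<bullet> K\<inverse> \<nabla>f\<close>. Its hypothesis holds for all small \<open>\<epsilon>\<close> by a second order expansion of
  \<open>V \<circ> exp\<close>, uniformly because \<open>f\<close> has compact support. Comparing the coefficients of \<open>\<epsilon>\<^sup>2\<close>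
  in the conclusion as \<open>\<epsilon> \<rightarrow> 0\<close> gives the variance bound. The Jacobian of the
  substitution is absorbed by working on the orthant with geometric instead of arithmetic means.
\<close>

section \<open>The Prekopa--Leindler inequality\<close>

text \<open>The signs \<open>\<epsilon> f\<close> and \<open>- \<epsilon> f\<close> are paired
  because the first order terms then cancel in the product of the two exponential moments, and the
  coefficient of \<open>\<epsilon>\<^sup>2\<close> is the variance. For points
  \<open>exp (z + \<epsilon> k)\<close> and \<open>exp (z - \<epsilon> k)\<close> the gain of
  \<open>f\<close> and the convexity loss of \<open>V \<circ> exp\<close> combine at second order
  into \<open>\<epsilon>\<^sup>2 / 2 * (2 * (\<nabla>f \<bullet> w) - w \<bullet> K w)\<close> with
  \<open>w = D k\<close>. The maximum over \<open>w\<close> is the Legendre dual of the quadratic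
  form of \<open>K\<close>; this is how the inverse matrix arises. The obstacle is that the
  expansion is local, whereas the inequality is needed for all pairs of points, and \<open>K\<close>
  has no uniform lower bound on the orthant. Pairs with both points off the support of
  \<open>f\<close> need only convexity. Otherwise one point lies in a compact set, and the midpoint
  deficit of a convex function along a ray from that point increases with the step, so a lower bound
  on \<open>K\<close> near the compact set also controls distant partners. The Jacobian causes no
  loss since it is log-linear in \<open>z\<close>: it satisfies the midpoint hypothesis with
  equality.\<close>

lemma emeasure_vimage_midpoint:
  fixes c :: real
  assumes [measurable]: "C \<in> sets borel"
  shows "emeasure lborel {x. (x + c) / 2 \<in> C} = 2 * emeasure lborel C"
proof -
  have "emeasure lborel C = (\<integral>\<^sup>+x. indicator C x \<partial>lborel)" by simp
  also have "\<dots> = ennreal \<bar>1/2\<bar> * (\<integral>\<^sup>+x. indicator C (c/2 + 1/2 * x) \<partial>lborel)"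
    by (rule nn_integral_real_affine) auto
  also have "(\<lambda>x. indicator C (c/2 + 1/2 * x) :: ennreal) = indicator {x. (x + c) / 2 \<in> C}"
    by (auto simp: fun_eq_iff indicator_def field_simps)
  finally have "emeasure lborel C = ennreal (1/2) * emeasure lborel {x. (x + c) / 2 \<in> C}"
    by simp
  then have "2 * emeasure lborel C = (ennreal 2 * ennreal (1/2)) * emeasure lborel {x. (x + c) / 2 \<in> C}"
    by (simp add: mult.assoc)
  moreover have "ennreal 2 * ennreal (1/2) = 1"
    by (subst ennreal_mult[symmetric]) auto
  ultimately show ?thesis by simp
qed

text \<open>Midpoints of \<open>b\<close> with points of \<open>A\<close> below \<open>a\<close> lie
  in \<open>C\<close> to the left of \<open>(a + b) / 2\<close>, and midpoints of \<open>a\<close>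
  with points of \<open>B\<close> above \<open>b\<close> lie in \<open>C\<close> to its right. So
  half-size copies of both pieces fit into \<open>C\<close> side by side.\<close>

lemma brunn_minkowski_split:
  fixes A B C :: "real set"
  assumes [measurable]: "A \<in> sets borel" "B \<in> sets borel" "C \<in> sets borel"
    and mid: "\<And>x y. x \<in> A \<Longrightarrow> y \<in> B \<Longrightarrow> (x + y) / 2 \<in> C"
    and a: "a \<in> A" and b: "b \<in> B"
  shows "emeasure lborel (A \<inter> {..a}) + emeasure lborel (B \<inter> {b..}) \<le> 2 * emeasure lborel C"
proof -
  define m where "m = (a + b) / 2"
  have [measurable]: "{x. (x + b) / 2 \<in> C \<inter> {..m}} \<in> sets borel" "{x. (x + a) / 2 \<in> C \<inter> {m<..}} \<in> sets borel"
    by measurable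
  have 1: "emeasure lborel (A \<inter> {..a}) \<le> 2 * emeasure lborel (C \<inter> {..m})"
    unfolding emeasure_vimage_midpoint[of "C \<inter> {..m}" b, simplified, symmetric]
    using mid[OF _ b] by (intro emeasure_mono) (auto simp: m_def)
  \<comment> \<open>The two copies could meet in \<open>m\<close> alone. Dropping the null point
    \<open>b\<close> makes the right half-line open and the pieces disjoint.\<close>
  have "emeasure lborel (B \<inter> {b..}) = emeasure lborel (B \<inter> {b<..})"
    by (intro emeasure_eq_AE) (use AE_lborel_singleton[of b] in \<open>auto elim!: eventually_mono\<close>)
  also have "\<dots> \<le> 2 * emeasure lborel (C \<inter> {m<..})"
    unfolding emeasure_vimage_midpoint[of "C \<inter> {m<..}" a, simplified, symmetric]
    using mid[OF a] by (intro emeasure_mono) (auto simp: m_def add.commute)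
  finally have "emeasure lborel (A \<inter> {..a}) + emeasure lborel (B \<inter> {b..})
      \<le> 2 * (emeasure lborel (C \<inter> {..m}) + emeasure lborel (C \<inter> {m<..}))"
    using 1 by (simp add: distrib_left add_mono)
  also have "emeasure lborel (C \<inter> {..m}) + emeasure lborel (C \<inter> {m<..}) = emeasure lborel C"
    by (subst plus_emeasure) (auto intro!: arg_cong[where f="emeasure lborel"])
  finally show ?thesis .
qed

text \<open>With \<open>a\<close> near \<open>Sup A\<close> and \<open>b\<close> near
  \<open>Inf B\<close> the parts lost in \<open>brunn_minkowski_split\<close> lie in intervals of
  length at most \<open>e / 2\<close> each. Working up to \<open>e\<close> avoids assuming that the
  extrema are attained.\<close>

lemma brunn_minkowski_midpoint_bounded:
  fixes A B C :: "real set"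
  assumes [measurable]: "A \<in> sets borel" "B \<in> sets borel" "C \<in> sets borel"
    and mid: "\<And>x y. x \<in> A \<Longrightarrow> y \<in> B \<Longrightarrow> (x + y) / 2 \<in> C"
    and ne: "A \<noteq> {}" "B \<noteq> {}" and bd: "bdd_above A" "bdd_below B"
  shows "emeasure lborel A + emeasure lborel B \<le> 2 * emeasure lborel C"
proof (rule ennreal_le_epsilon)
  fix e :: real assume "e > 0"
  then have e2: "e / 2 > 0" by simp
  obtain a where a: "a \<in> A" "Sup A - e/2 < a"
    using less_cSup_iff[OF ne(1) bd(1), of "Sup A - e/2"] e2 by auto
  obtain b where b: "b \<in> B" "b < Inf B + e/2"
    using cInf_less_iff[OF ne(2) bd(2), of "Inf B + e/2"] e2 by auto
  have "emeasure lborel A \<le> emeasure lborel ((A \<inter> {..a}) \<union> {a..Sup A})"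
    by (intro emeasure_mono) (auto simp: cSup_upper[OF _ bd(1)])
  also have "\<dots> \<le> emeasure lborel (A \<inter> {..a}) + emeasure lborel {a..Sup A}"
    by (intro emeasure_subadditive) auto
  also have "\<dots> \<le> emeasure lborel (A \<inter> {..a}) + ennreal (e/2)"
    using a cSup_upper[OF a(1) bd(1)] by (intro add_left_mono) (auto intro!: ennreal_leI)
  finally have A: "emeasure lborel A \<le> emeasure lborel (A \<inter> {..a}) + ennreal (e/2)" .
  have "emeasure lborel B \<le> emeasure lborel ((B \<inter> {b..}) \<union> {Inf B..b})"
    by (intro emeasure_mono) (auto simp: cInf_lower[OF _ bd(2)])
  also have "\<dots> \<le> emeasure lborel (B \<inter> {b..}) + emeasure lborel {Inf B..b}"
    by (intro emeasure_subadditive) auto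
  also have "\<dots> \<le> emeasure lborel (B \<inter> {b..}) + ennreal (e/2)"
    using b cInf_lower[OF b(1) bd(2)] by (intro add_left_mono) (auto intro!: ennreal_leI)
  finally have B: "emeasure lborel B \<le> emeasure lborel (B \<inter> {b..}) + ennreal (e/2)" .
  have "emeasure lborel A + emeasure lborel B
      \<le> (emeasure lborel (A \<inter> {..a}) + ennreal (e/2)) + (emeasure lborel (B \<inter> {b..}) + ennreal (e/2))"
    by (intro add_mono A B)
  also have "\<dots> = (emeasure lborel (A \<inter> {..a}) + emeasure lborel (B \<inter> {b..})) + ennreal (e/2 + e/2)"
    using e2 by (subst ennreal_plus) (auto simp: algebra_simps)
  also have "\<dots> \<le> 2 * emeasure lborel C + ennreal e"
    using brunn_minkowski_split[OF assms(1-3) mid a(1) b(1)] by (simp add: add_right_mono)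
  finally show "emeasure lborel A + emeasure lborel B \<le> 2 * emeasure lborel C + ennreal e" .
qed

lemma brunn_minkowski_midpoint:
  fixes A B C :: "real set"
  assumes [measurable]: "A \<in> sets borel" "B \<in> sets borel" "C \<in> sets borel"
    and mid: "\<And>x y. x \<in> A \<Longrightarrow> y \<in> B \<Longrightarrow> (x + y) / 2 \<in> C"
    and ne: "A \<noteq> {}" "B \<noteq> {}"
  shows "emeasure lborel A + emeasure lborel B \<le> 2 * emeasure lborel C"
proof -
  obtain a b where ab: "a \<in> A" "b \<in> B" using ne by auto
  \<comment> \<open>The truncations start from points \<open>a\<close> and \<open>b\<close> of the
    sets so that both stay nonempty; the inequality fails if one of the sets is empty.\<close>
  have fin: "emeasure lborel (A \<inter> {..a + real n}) + emeasure lborel (B \<inter> {b - real n..})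
      \<le> 2 * emeasure lborel C" for n
  proof (rule brunn_minkowski_midpoint_bounded)
    show "A \<inter> {..a + real n} \<noteq> {}" "B \<inter> {b - real n..} \<noteq> {}"
      using ab by (auto intro: exI[of _ a] exI[of _ b])
  qed (use mid in auto)
  have "(\<lambda>n. emeasure lborel (A \<inter> {..a + real n})) \<longlonglongrightarrow> emeasure lborel (\<Union>n. A \<inter> {..a + real n})"
    by (rule Lim_emeasure_incseq) (auto simp: incseq_def)
  also have "(\<Union>n. A \<inter> {..a + real n}) = A"
  proof -
    have "\<exists>n. x \<le> a + real n" for x using real_arch_simple[of "x - a"] by (auto simp: algebra_simps)
    then show ?thesis by auto
  qed
  finally have LA: "(\<lambda>n. emeasure lborel (A \<inter> {..a + real n})) \<longlonglongrightarrow> emeasure lborel A" .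
  have "(\<lambda>n. emeasure lborel (B \<inter> {b - real n..})) \<longlonglongrightarrow> emeasure lborel (\<Union>n. B \<inter> {b - real n..})"
    by (rule Lim_emeasure_incseq) (auto simp: incseq_def)
  also have "(\<Union>n. B \<inter> {b - real n..}) = B"
  proof -
    have "\<exists>n. b - real n \<le> x" for x using real_arch_simple[of "b - x"] by (auto simp: algebra_simps)
    then show ?thesis by auto
  qed
  finally have LB: "(\<lambda>n. emeasure lborel (B \<inter> {b - real n..})) \<longlonglongrightarrow> emeasure lborel B" .
  show ?thesis
    by (rule LIMSEQ_le_const2[OF tendsto_add[OF LA LB]]) (use fin in auto)
qed

text \<open>Fubini for the region below the graph, with levels written as \<open>s * a\<close> for
  \<open>s\<close> in the unit interval. The rescaling allows functions with different suprema to be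
  compared at the same relative level \<open>s\<close>.\<close>

lemma nn_integral_layer_cake:
  fixes u :: "real \<Rightarrow> ennreal"
  assumes [measurable]: "u \<in> borel_measurable borel" and a: "a > 0" and le: "\<And>x. u x \<le> ennreal a"
  shows "(\<integral>\<^sup>+x. u x \<partial>lborel)
    = ennreal a * (\<integral>\<^sup>+s. indicator {0<..<1} s * emeasure lborel {x. ennreal (s * a) < u x} \<partial>lborel)"
proof -
  have inner: "(\<integral>\<^sup>+s. indicator {0<..<1} s * indicator {s. ennreal (s * a) < u x} s \<partial>lborel) * ennreal a = u x" for x
  proof -
    obtain r where r: "u x = ennreal r" "0 \<le> r" "r \<le> a"
      using le[of x] a by (cases "u x") (auto simp: top_unique)
    have "ennreal (s * a) < u x \<longleftrightarrow> s < r / a" if "0 < s" for s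
      using r a that by (simp add: ennreal_less_iff pos_less_divide_eq)
    moreover have "r / a \<le> 1" using r a by simp
    ultimately have "(\<lambda>s. indicator {0<..<1} s * indicator {s. ennreal (s * a) < u x} s :: ennreal)
        = indicator {0<..<r/a}"
      by (intro ext) (auto simp: indicator_def)
    then show ?thesis
      using r a by (simp add: ennreal_mult[symmetric])
  qed
  have "(\<integral>\<^sup>+x. u x \<partial>lborel)
      = (\<integral>\<^sup>+x. (\<integral>\<^sup>+s. indicator {0<..<1} s * indicator {s. ennreal (s * a) < u x} s \<partial>lborel) * ennreal a \<partial>lborel)"
    unfolding inner ..
  also have "\<dots> = (\<integral>\<^sup>+x. (\<integral>\<^sup>+s. indicator {0<..<1} s * indicator {s. ennreal (s * a) < u x} s \<partial>lborel) \<partial>lborel) * ennreal a"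
    by (rule nn_integral_multc) measurable
  also have "(\<integral>\<^sup>+x. (\<integral>\<^sup>+s. indicator {0<..<1} s * indicator {s. ennreal (s * a) < u x} s \<partial>lborel) \<partial>lborel)
     = (\<integral>\<^sup>+s. (\<integral>\<^sup>+x. indicator {0<..<1} s * indicator {s. ennreal (s * a) < u x} s \<partial>lborel) \<partial>lborel)"
    by (rule lborel_pair.Fubini') measurable
  also have "\<dots> = (\<integral>\<^sup>+s. indicator {0<..<1} s * emeasure lborel {x. ennreal (s * a) < u x} \<partial>lborel)"
  proof (intro nn_integral_cong)
    fix s :: real
    have "(\<integral>\<^sup>+x. indicator {0<..<1} s * indicator {s. ennreal (s * a) < u x} s \<partial>lborel)
      = (\<integral>\<^sup>+x. indicator {0<..<1} s * indicator {x. ennreal (s * a) < u x} x \<partial>lborel)"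
      by (intro nn_integral_cong) (auto simp: indicator_def)
    also have "\<dots> = indicator {0<..<1} s * (\<integral>\<^sup>+x. indicator {x. ennreal (s * a) < u x} x \<partial>lborel)"
      by (rule nn_integral_cmult) measurable
    finally show "(\<integral>\<^sup>+x. indicator {0<..<1} s * indicator {s. ennreal (s * a) < u x} s \<partial>lborel)
      = indicator {0<..<1} s * emeasure lborel {x. ennreal (s * a) < u x}"
      by simp
  qed
  finally show ?thesis by (simp add: mult.commute)
qed

lemma ennreal_am_gm: "4 * (x * y) \<le> (x + y)\<^sup>2" for x y :: ennreal
proof (cases "x = top \<or> y = top")
  case True
  then show ?thesis by (auto simp: power2_eq_square)
next
  case False
  then obtain a b where ab: "x = ennreal a" "0 \<le> a" "y = ennreal b" "0 \<le> b"
    by (cases x; cases y) auto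
  have "4 * (a * b) \<le> (a + b)\<^sup>2"
    using zero_le_power2[of "a - b"] by (simp add: power2_eq_square algebra_simps)
  then have "ennreal (4 * (a * b)) \<le> ennreal ((a + b)\<^sup>2)"
    by (rule ennreal_leI)
  moreover have "ennreal (4 * (a * b)) = 4 * (x * y)"
    using ab by (simp add: ennreal_mult)
  moreover have "ennreal ((a + b)\<^sup>2) = (x + y)\<^sup>2"
    using ab by (simp add: ennreal_power[symmetric])
  ultimately show ?thesis by simp
qed

text \<open>Levels are measured relative to the suprema \<open>a\<close> and \<open>b\<close> of
  \<open>u\<close> and \<open>v\<close>, and to \<open>c = sqrt (a * b)\<close> for
  \<open>w\<close>. At every relative level \<open>s < 1\<close> the superlevel sets of
  \<open>u\<close> and \<open>v\<close> are nonempty and their midpoints lie in that of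
  \<open>w\<close>, because \<open>(s * c)\<^sup>2 = (s * a) * (s * b)\<close>. Integrating
  Brunn--Minkowski over \<open>s\<close> gives an additive inequality, which AM-GM turns into the
  product form. Boundedness makes the suprema finite.\<close>

lemma prekopa_leindler_midpoint_bounded:
  fixes u v w :: "real \<Rightarrow> ennreal"
  assumes [measurable]: "u \<in> borel_measurable borel" "v \<in> borel_measurable borel" "w \<in> borel_measurable borel"
    and le: "\<And>x y. u x * v y \<le> (w ((x + y) / 2))\<^sup>2"
    and bdd: "\<And>x. u x \<le> ennreal (real n)" "\<And>x. v x \<le> ennreal (real m)"
  shows "(\<integral>\<^sup>+x. u x \<partial>lborel) * (\<integral>\<^sup>+x. v x \<partial>lborel) \<le> (\<integral>\<^sup>+x. w x \<partial>lborel)\<^sup>2"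
proof (cases "(SUP x. u x) = 0 \<or> (SUP x. v x) = 0")
  case True
  then have "(\<forall>x. u x = 0) \<or> (\<forall>x. v x = 0)"
    by (auto simp: SUP_eq_iff bot_ennreal[symmetric])
  then show ?thesis by auto
next
  case False
  have "(SUP x. u x) \<le> ennreal (real n)" "(SUP x. v x) \<le> ennreal (real m)"
    using bdd by (auto intro: SUP_least)
  then obtain a b where ab: "(SUP x. u x) = ennreal a" "(SUP x. v x) = ennreal b" "a > 0" "b > 0"
    using False by (cases "SUP x. u x"; cases "SUP x. v x") (auto simp: top_unique order_le_less)
  define c where "c = sqrt (a * b)"
  have c: "c > 0" "c\<^sup>2 = a * b" using ab by (auto simp: c_def)
  define I where "I h r = (\<integral>\<^sup>+s. indicator {0<..<1} s * emeasure lborel {x. ennreal (s * r) < h x} \<partial>lborel)"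
    for h :: "real \<Rightarrow> ennreal" and r :: real
  have u: "(\<integral>\<^sup>+x. u x \<partial>lborel) = ennreal a * I u a"
    unfolding I_def by (rule nn_integral_layer_cake) (use ab in \<open>auto intro: SUP_upper2 simp flip: ab(1)\<close>)
  have v: "(\<integral>\<^sup>+x. v x \<partial>lborel) = ennreal b * I v b"
    unfolding I_def by (rule nn_integral_layer_cake) (use ab in \<open>auto intro: SUP_upper2 simp flip: ab(2)\<close>)
  have "(\<integral>\<^sup>+x. min (w x) (ennreal c) \<partial>lborel) = ennreal c * I (\<lambda>x. min (w x) (ennreal c)) c"
    unfolding I_def by (rule nn_integral_layer_cake) (use c in auto)
  \<comment> \<open>The function \<open>w\<close> may exceed \<open>c\<close>, whereas the layer
    cake formula needs a bound. Cutting at \<open>c\<close> does not change the superlevel sets at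
    levels \<open>s * c\<close> with \<open>s < 1\<close> and can only lower the integral.\<close>
  also have "I (\<lambda>x. min (w x) (ennreal c)) c = I w c"
  proof -
    have "s * c < c" if "s < 1" for s using that c by simp
    then show ?thesis
      unfolding I_def using c
      by (intro nn_integral_cong) (auto simp: indicator_def ennreal_less_iff)
  qed
  finally have w: "ennreal c * I w c \<le> (\<integral>\<^sup>+x. w x \<partial>lborel)"
    by (metis (no_types, lifting) min.cobounded1 nn_integral_mono)
  have "I u a + I v b = (\<integral>\<^sup>+s. indicator {0<..<1} s * emeasure lborel {x. ennreal (s * a) < u x}
        + indicator {0<..<1} s * emeasure lborel {x. ennreal (s * b) < v x} \<partial>lborel)"
    unfolding I_def by (rule nn_integral_add[symmetric]) measurable
  also have "\<dots> \<le> (\<integral>\<^sup>+s. 2 * (indicator {0<..<1} s * emeasure lborel {x. ennreal (s * c) < w x}) \<partial>lborel)"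
  proof (intro nn_integral_mono)
    fix s :: real
    show "indicator {0<..<1} s * emeasure lborel {x. ennreal (s * a) < u x}
        + indicator {0<..<1} s * emeasure lborel {x. ennreal (s * b) < v x}
        \<le> 2 * (indicator {0<..<1} s * emeasure lborel {x. ennreal (s * c) < w x})"
    proof (cases "s \<in> {0<..<1}")
      case True
      then have s: "0 < s" "s < 1" by auto
      have "emeasure lborel {x. ennreal (s * a) < u x} + emeasure lborel {x. ennreal (s * b) < v x}
          \<le> 2 * emeasure lborel {x. ennreal (s * c) < w x}"
      proof (rule brunn_minkowski_midpoint)
        have "ennreal (s * a) < (SUP x. u x)" "ennreal (s * b) < (SUP x. v x)"
          using s ab by (auto simp: ennreal_less_iff)
        then show "{x. ennreal (s * a) < u x} \<noteq> {}" "{x. ennreal (s * b) < v x} \<noteq> {}"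
          by (auto simp: less_SUP_iff)
        fix x y assume "x \<in> {x. ennreal (s * a) < u x}" "y \<in> {x. ennreal (s * b) < v x}"
        then have xy: "ennreal (s * a) < u x" "ennreal (s * b) < v y" by auto
        have "ennreal (s * a) * ennreal (s * b) < u x * ennreal (s * b)"
          using xy(1) s ab ennreal_mult_le_mult_iff[of "ennreal (s * b)" "u x" "ennreal (s * a)"]
          by (simp add: mult.commute flip: not_le)
        also have "\<dots> \<le> u x * v y"
          using xy(2) by (intro mult_left_mono) auto
        also have "\<dots> \<le> (w ((x + y) / 2))\<^sup>2" by (rule le)
        finally have "(ennreal (s * c))\<^sup>2 < (w ((x + y) / 2))\<^sup>2"
          using s ab c by (simp add: ennreal_power power_mult_distrib ennreal_mult[symmetric] power2_eq_square[of s] algebra_simps)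
        then have "ennreal (s * c) < w ((x + y) / 2)"
          by (meson not_less power_mono zero_le)
        then show "(x + y) / 2 \<in> {x. ennreal (s * c) < w x}" by simp
      qed measurable
      with True show ?thesis by simp
    qed simp
  qed
  also have "\<dots> = 2 * I w c"
    unfolding I_def by (rule nn_integral_cmult) measurable
  finally have I: "I u a + I v b \<le> 2 * I w c" .
  have "4 * ((\<integral>\<^sup>+x. u x \<partial>lborel) * (\<integral>\<^sup>+x. v x \<partial>lborel)) = (ennreal c)\<^sup>2 * (4 * (I u a * I v b))"
    unfolding u v using c ab by (simp add: ennreal_power ennreal_mult mult_ac)
  also have "\<dots> \<le> (ennreal c)\<^sup>2 * (I u a + I v b)\<^sup>2"
    by (intro mult_left_mono ennreal_am_gm) auto
  also have "\<dots> \<le> (ennreal c)\<^sup>2 * (2 * I w c)\<^sup>2"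
    by (intro mult_left_mono power_mono I) auto
  also have "\<dots> = 4 * (ennreal c * I w c)\<^sup>2"
    by (simp add: power_mult_distrib mult_ac)
  also have "\<dots> \<le> 4 * (\<integral>\<^sup>+x. w x \<partial>lborel)\<^sup>2"
    by (intro mult_left_mono power_mono w) auto
  finally show ?thesis
    by (simp add: ennreal_mult_le_mult_iff)
qed

lemma nn_integral_min_of_nat:
  fixes u :: "'a \<Rightarrow> ennreal"
  assumes [measurable]: "u \<in> borel_measurable M"
  shows "(SUP n. \<integral>\<^sup>+x. min (u x) (ennreal (real n)) \<partial>M) = (\<integral>\<^sup>+x. u x \<partial>M)"
proof -
  have "(SUP n. min (u x) (ennreal (real n))) = u x" for x
  proof -
    have "(SUP n. min (u x) (of_nat n)) = min (u x) (SUP n. of_nat n)"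
      by (simp add: inf_SUP flip: inf_min)
    then show ?thesis
      by (simp add: ennreal_SUP_of_nat_eq_top flip: ennreal_of_nat_eq_real_of_nat)
  qed
  then show ?thesis
    by (subst nn_integral_monotone_convergence_SUP[symmetric])
       (auto simp: incseq_def le_fun_def min.coboundedI2 intro!: min.mono ennreal_leI)
qed

text \<open>Truncating \<open>u\<close> and \<open>v\<close> preserves the hypothesis for the same
  \<open>w\<close>. The two cut-off levels are independent, so the supremum of the product splits
  into the product of suprema.\<close>

lemma prekopa_leindler_midpoint:
  fixes u v w :: "real \<Rightarrow> ennreal"
  assumes [measurable]: "u \<in> borel_measurable borel" "v \<in> borel_measurable borel" "w \<in> borel_measurable borel"
    and le: "\<And>x y. u x * v y \<le> (w ((x + y) / 2))\<^sup>2"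
  shows "(\<integral>\<^sup>+x. u x \<partial>lborel) * (\<integral>\<^sup>+x. v x \<partial>lborel) \<le> (\<integral>\<^sup>+x. w x \<partial>lborel)\<^sup>2"
proof -
  have "(\<integral>\<^sup>+x. min (u x) (ennreal (real n)) \<partial>lborel) * (\<integral>\<^sup>+x. min (v x) (ennreal (real m)) \<partial>lborel)
      \<le> (\<integral>\<^sup>+x. w x \<partial>lborel)\<^sup>2" for n m
  proof (rule prekopa_leindler_midpoint_bounded[where n=n and m=m])
    fix x y
    have "min (u x) (ennreal (real n)) * min (v y) (ennreal (real m)) \<le> u x * v y"
      by (intro mult_mono) auto
    also note le
    finally show "min (u x) (ennreal (real n)) * min (v y) (ennreal (real m)) \<le> (w ((x + y) / 2))\<^sup>2" .
  qed auto
  then have "(SUP n. SUP m. (\<integral>\<^sup>+x. min (u x) (ennreal (real n)) \<partial>lborel) * (\<integral>\<^sup>+x. min (v x) (ennreal (real m)) \<partial>lborel))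
      \<le> (\<integral>\<^sup>+x. w x \<partial>lborel)\<^sup>2"
    by (intro SUP_least)
  then show ?thesis
    by (simp add: SUP_mult_left_ennreal[symmetric] SUP_mult_right_ennreal[symmetric] nn_integral_min_of_nat)
qed

section \<open>Geometric means and products of half-lines\<close>

lemma nn_integral_exp_substitution:
  fixes u :: "real \<Rightarrow> ennreal"
  assumes [measurable]: "u \<in> borel_measurable borel" and 0: "\<And>x. x \<le> 0 \<Longrightarrow> u x = 0"
  shows "(\<integral>\<^sup>+x. u x \<partial>lborel) = (\<integral>\<^sup>+z. u (exp z) * ennreal (exp z) \<partial>lborel)"
proof -
  \<comment> \<open>Substitution is done on compact intervals and extended by monotone convergence;
    with \<open>Suc n\<close> the interval has positive length already for
    \<open>n = 0\<close>.\<close>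
  have eq: "(\<integral>\<^sup>+x. u x * indicator {exp (- real (Suc n))..exp (real (Suc n))} x \<partial>lborel)
     = (\<integral>\<^sup>+z. u (exp z) * ennreal (exp z) * indicator {- real (Suc n)..real (Suc n)} z \<partial>lborel)" for n
    by (rule nn_integral_substitution_aux) (auto intro!: derivative_eq_intros continuous_intros)
  have sup: "(SUP n. c * indicator (S n) x) = c" if ex: "\<exists>n. x \<in> S n"
    for c :: ennreal and S :: "nat \<Rightarrow> real set" and x
  proof -
    obtain n where "x \<in> S n" using ex by auto
    then have "c \<le> (SUP n. c * indicator (S n) x)" by (intro SUP_upper2[of n]) auto
    then show ?thesis by (intro antisym SUP_least) (auto simp: indicator_def)
  qed
  have "(SUP n. u x * indicator {exp (- real (Suc n))..exp (real (Suc n))} x) = u x" for x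
  proof (cases "x > 0")
    case True
    obtain n where "\<bar>ln x\<bar> \<le> real n" using real_arch_simple by blast
    then have "- real (Suc n) \<le> ln x" "ln x \<le> real (Suc n)" by auto
    then have "x \<in> {exp (- real (Suc n))..exp (real (Suc n))}"
      using True by (metis atLeastAtMost_iff exp_le_cancel_iff exp_ln)
    then show ?thesis by (intro sup) blast
  qed (simp add: 0)
  moreover have mono: "x \<le> exp (1 + real n)" if "x \<le> exp (1 + real m)" "m \<le> n" for x m n
    by (rule order_trans[OF that(1)]) (use that(2) in simp)
  moreover have mono': "exp (- 1 - real n) \<le> x" if "exp (- 1 - real m) \<le> x" "m \<le> n" for x m n
    by (rule order_trans[OF _ that(1)]) (use that(2) in simp)
  ultimately have "(\<integral>\<^sup>+x. u x \<partial>lborel) = (\<integral>\<^sup>+x. (SUP n. u x * indicator {exp (- real (Suc n))..exp (real (Suc n))} x) \<partial>lborel)"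
    by simp
  also have "\<dots> = (SUP n. \<integral>\<^sup>+x. u x * indicator {exp (- real (Suc n))..exp (real (Suc n))} x \<partial>lborel)"
    by (rule nn_integral_monotone_convergence_SUP)
       (auto simp: incseq_def le_fun_def indicator_def dest: mono mono')
  also have "\<dots> = (SUP n. \<integral>\<^sup>+z. u (exp z) * ennreal (exp z) * indicator {- real (Suc n)..real (Suc n)} z \<partial>lborel)"
    unfolding eq ..
  also have "\<dots> = (\<integral>\<^sup>+z. (SUP n. u (exp z) * ennreal (exp z) * indicator {- real (Suc n)..real (Suc n)} z) \<partial>lborel)"
    by (rule nn_integral_monotone_convergence_SUP[symmetric])
       (auto simp: incseq_def le_fun_def indicator_def)
  also have "\<dots> = (\<integral>\<^sup>+z. u (exp z) * ennreal (exp z) \<partial>lborel)"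
  proof (intro nn_integral_cong sup)
    fix z :: real
    obtain n where "\<bar>z\<bar> \<le> real n" using real_arch_simple by blast
    then show "\<exists>n. z \<in> {- real (Suc n)..real (Suc n)}" by (intro exI[of _ n]) auto
  qed
  finally show ?thesis .
qed

text \<open>The weight \<open>exp z\<close> coming from the substitution satisfies
  \<open>exp x * exp y = (exp ((x + y) / 2))\<^sup>2\<close>, so multiplying the three functions by
  it preserves the midpoint hypothesis.\<close>

lemma prekopa_leindler_geometric:
  fixes u v w :: "real \<Rightarrow> ennreal"
  assumes [measurable]: "u \<in> borel_measurable borel" "v \<in> borel_measurable borel" "w \<in> borel_measurable borel"
    and 0: "\<And>x. x \<le> 0 \<Longrightarrow> u x = 0" "\<And>x. x \<le> 0 \<Longrightarrow> v x = 0"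
    and le: "\<And>x y. x > 0 \<Longrightarrow> y > 0 \<Longrightarrow> u x * v y \<le> (w (sqrt (x * y)))\<^sup>2"
  shows "(\<integral>\<^sup>+x. u x \<partial>lborel) * (\<integral>\<^sup>+x. v x \<partial>lborel) \<le> (\<integral>\<^sup>+x. w x \<partial>lborel)\<^sup>2"
proof -
  \<comment> \<open>Unlike \<open>u\<close> and \<open>v\<close>, \<open>w\<close> need not vanish
    off the half-line as the substitution requires; cutting it there only lowers the right-hand
    side.\<close>
  define w' where "w' x = w x * indicator {0<..} x" for x
  have [measurable]: "w' \<in> borel_measurable borel" unfolding w'_def by measurable
  have "(\<integral>\<^sup>+x. u x \<partial>lborel) * (\<integral>\<^sup>+x. v x \<partial>lborel)
      = (\<integral>\<^sup>+z. u (exp z) * ennreal (exp z) \<partial>lborel) * (\<integral>\<^sup>+z. v (exp z) * ennreal (exp z) \<partial>lborel)"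
    using 0 by (simp add: nn_integral_exp_substitution)
  also have "\<dots> \<le> (\<integral>\<^sup>+z. w' (exp z) * ennreal (exp z) \<partial>lborel)\<^sup>2"
  proof (rule prekopa_leindler_midpoint)
    fix x y :: real
    have half: "sqrt (exp x * exp y) = exp ((x + y) / 2)"
      by (rule real_sqrt_unique) (auto simp: power2_eq_square simp flip: exp_add)
    have "u (exp x) * ennreal (exp x) * (v (exp y) * ennreal (exp y))
        = (u (exp x) * v (exp y)) * (ennreal (exp x) * ennreal (exp y))"
      by (simp add: mult_ac)
    also have "\<dots> \<le> (w (exp ((x + y) / 2)))\<^sup>2 * (ennreal (exp x) * ennreal (exp y))"
      using le[of "exp x" "exp y"] by (intro mult_right_mono) (auto simp: half)
    also have "ennreal (exp x) * ennreal (exp y) = (ennreal (exp ((x + y) / 2)))\<^sup>2"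
      by (simp add: ennreal_power ennreal_mult[symmetric] power2_eq_square flip: exp_add)
    finally show "u (exp x) * ennreal (exp x) * (v (exp y) * ennreal (exp y))
        \<le> (w' (exp ((x + y) / 2)) * ennreal (exp ((x + y) / 2)))\<^sup>2"
      by (simp add: power_mult_distrib w'_def)
  qed measurable
  also have "(\<integral>\<^sup>+z. w' (exp z) * ennreal (exp z) \<partial>lborel) = (\<integral>\<^sup>+x. w' x \<partial>lborel)"
    by (rule nn_integral_exp_substitution[symmetric]) (auto simp: w'_def)
  also have "(\<integral>\<^sup>+x. w' x \<partial>lborel)\<^sup>2 \<le> (\<integral>\<^sup>+x. w x \<partial>lborel)\<^sup>2"
    by (intro power_mono nn_integral_mono) (auto simp: w'_def indicator_def)
  finally show ?thesis .
qed

text \<open>The hypothesis is inherited by partial integrals: for fixed values \<open>t\<close> and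
  \<open>s\<close> of the new coordinate, the induction hypothesis on the remaining coordinates is
  exactly the one-dimensional hypothesis at \<open>sqrt (t * s)\<close>. The argument of
  \<open>w\<close> is restricted to \<open>I\<close> because the points of the product space are
  extensional functions.\<close>

lemma prekopa_leindler_geometric_PiM:
  fixes u v w :: "('i \<Rightarrow> real) \<Rightarrow> ennreal"
  assumes "finite I"
    and "u \<in> borel_measurable (Pi\<^sub>M I (\<lambda>_. lborel))"
    and "v \<in> borel_measurable (Pi\<^sub>M I (\<lambda>_. lborel))"
    and "w \<in> borel_measurable (Pi\<^sub>M I (\<lambda>_. lborel))"
    and "\<And>x i. i \<in> I \<Longrightarrow> x i \<le> 0 \<Longrightarrow> u x = 0"
    and "\<And>x i. i \<in> I \<Longrightarrow> x i \<le> 0 \<Longrightarrow> v x = 0"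
    and "\<And>x y. (\<And>i. i \<in> I \<Longrightarrow> 0 < x i) \<Longrightarrow> (\<And>i. i \<in> I \<Longrightarrow> 0 < y i) \<Longrightarrow>
          u x * v y \<le> (w (\<lambda>i\<in>I. sqrt (x i * y i)))\<^sup>2"
  shows "(\<integral>\<^sup>+x. u x \<partial>Pi\<^sub>M I (\<lambda>_. lborel)) * (\<integral>\<^sup>+x. v x \<partial>Pi\<^sub>M I (\<lambda>_. lborel))
    \<le> (\<integral>\<^sup>+x. w x \<partial>Pi\<^sub>M I (\<lambda>_. lborel))\<^sup>2"
  using assms
proof (induction I arbitrary: u v w rule: finite_induct)
  case empty
  interpret product_sigma_finite "\<lambda>_::'i. lborel :: real measure" by standard
  \<comment> \<open>The product over the empty set is a unit mass at this single function, so the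
    claim is the pointwise hypothesis itself.\<close>
  have "u (\<lambda>_. undefined) * v (\<lambda>_. undefined) \<le> (w (\<lambda>i\<in>{}. sqrt (undefined * undefined)))\<^sup>2"
    by (rule empty.prems(6)) auto
  then show ?case
    by (simp add: nn_integral_empty restrict_def)
next
  case (insert i J)
  interpret product_sigma_finite "\<lambda>_::'i. lborel :: real measure" by standard
  interpret J: finite_product_sigma_finite "\<lambda>_::'i. lborel :: real measure" J
    by standard (use insert in auto)
  have [measurable]: "(\<lambda>p. h ((snd p)(i := fst p))) \<in> borel_measurable (borel \<Otimes>\<^sub>M Pi\<^sub>M J (\<lambda>_. lborel))"
    if "h \<in> borel_measurable (Pi\<^sub>M (insert i J) (\<lambda>_. lborel))" for h :: "('i \<Rightarrow> real) \<Rightarrow> ennreal"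
  proof -
    have "(\<lambda>p. (snd p)(i := fst p)) \<in> measurable (borel \<Otimes>\<^sub>M Pi\<^sub>M J (\<lambda>_. lborel)) (Pi\<^sub>M (insert i J) (\<lambda>_. lborel))"
      by (rule measurable_fun_upd[where J=J]) auto
    then show ?thesis by (rule measurable_compose[OF _ that])
  qed
  have sec: "(\<lambda>x. h (x(i := t))) \<in> borel_measurable (Pi\<^sub>M J (\<lambda>_. lborel))"
    if "h \<in> borel_measurable (Pi\<^sub>M (insert i J) (\<lambda>_. lborel))" for h :: "('i \<Rightarrow> real) \<Rightarrow> ennreal" and t
  proof -
    have "(\<lambda>x. x(i := t)) \<in> measurable (Pi\<^sub>M J (\<lambda>_. lborel)) (Pi\<^sub>M (insert i J) (\<lambda>_. lborel))"
      by (rule measurable_fun_upd[where J=J]) auto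
    then show ?thesis by (rule measurable_compose[OF _ that])
  qed
  have int: "(\<integral>\<^sup>+x. h x \<partial>Pi\<^sub>M (insert i J) (\<lambda>_. lborel))
      = (\<integral>\<^sup>+t. (\<integral>\<^sup>+x. h (x(i := t)) \<partial>Pi\<^sub>M J (\<lambda>_. lborel)) \<partial>lborel)"
    if "h \<in> borel_measurable (Pi\<^sub>M (insert i J) (\<lambda>_. lborel))" for h :: "('i \<Rightarrow> real) \<Rightarrow> ennreal"
    using insert.hyps that by (rule product_nn_integral_insert_rev)
  show ?case
    unfolding int[OF insert.prems(1)] int[OF insert.prems(2)] int[OF insert.prems(3)]
  proof (rule prekopa_leindler_geometric)
    show "(\<lambda>t. \<integral>\<^sup>+x. u (x(i := t)) \<partial>Pi\<^sub>M J (\<lambda>_. lborel)) \<in> borel_measurable borel"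
         "(\<lambda>t. \<integral>\<^sup>+x. v (x(i := t)) \<partial>Pi\<^sub>M J (\<lambda>_. lborel)) \<in> borel_measurable borel"
         "(\<lambda>t. \<integral>\<^sup>+x. w (x(i := t)) \<partial>Pi\<^sub>M J (\<lambda>_. lborel)) \<in> borel_measurable borel"
      using insert.prems(1-3) by measurable
    fix t :: real assume t: "t \<le> 0"
    show "(\<integral>\<^sup>+x. u (x(i := t)) \<partial>Pi\<^sub>M J (\<lambda>_. lborel)) = 0" "(\<integral>\<^sup>+x. v (x(i := t)) \<partial>Pi\<^sub>M J (\<lambda>_. lborel)) = 0"
      using t by (simp_all add: insert.prems(4)[of i] insert.prems(5)[of i])
  next
    fix t s :: real assume ts: "t > 0" "s > 0"
    show "(\<integral>\<^sup>+x. u (x(i := t)) \<partial>Pi\<^sub>M J (\<lambda>_. lborel)) * (\<integral>\<^sup>+x. v (x(i := s)) \<partial>Pi\<^sub>M J (\<lambda>_. lborel))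
       \<le> (\<integral>\<^sup>+x. w (x(i := sqrt (t * s))) \<partial>Pi\<^sub>M J (\<lambda>_. lborel))\<^sup>2"
    proof (rule insert.IH)
      fix x k assume k: "k \<in> J" "x k \<le> (0::real)"
      with insert.hyps have "k \<noteq> i" by auto
      with k show "u (x(i := t)) = 0" "v (x(i := s)) = 0"
        by (auto intro!: insert.prems(4)[of k] insert.prems(5)[of k])
    next
      fix x y :: "'i \<Rightarrow> real"
      assume pos: "\<And>k. k \<in> J \<Longrightarrow> 0 < x k" "\<And>k. k \<in> J \<Longrightarrow> 0 < y k"
      have "u (x(i := t)) * v (y(i := s))
          \<le> (w (\<lambda>k\<in>insert i J. sqrt ((x(i := t)) k * (y(i := s)) k)))\<^sup>2"
        by (rule insert.prems(6)) (use pos ts in auto)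
      also have "(\<lambda>k\<in>insert i J. sqrt ((x(i := t)) k * (y(i := s)) k))
          = (\<lambda>k\<in>J. sqrt (x k * y k))(i := sqrt (t * s))"
        using insert.hyps by (auto simp: fun_eq_iff)
      finally show "u (x(i := t)) * v (y(i := s)) \<le> (w ((\<lambda>k\<in>J. sqrt (x k * y k))(i := sqrt (t * s))))\<^sup>2" .
    qed (intro sec insert.prems(1-3))+
  qed
qed

lemma prekopa_leindler_orthant:
  fixes u v w :: "real ^ 'n \<Rightarrow> ennreal"
  assumes [measurable]: "u \<in> borel_measurable borel" "v \<in> borel_measurable borel" "w \<in> borel_measurable borel"
    and 0: "\<And>x. x \<notin> orthant \<Longrightarrow> u x = 0" "\<And>x. x \<notin> orthant \<Longrightarrow> v x = 0"
    and le: "\<And>x y. x \<in> orthant \<Longrightarrow> y \<in> orthant \<Longrightarrow> u x * v y \<le> (w (\<chi> i. sqrt (x $ i * y $ i)))\<^sup>2"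
  shows "(\<integral>\<^sup>+x. u x \<partial>lborel) * (\<integral>\<^sup>+x. v x \<partial>lborel) \<le> (\<integral>\<^sup>+x. w x \<partial>lborel)\<^sup>2"
proof -
  \<comment> \<open>Lebesgue measure is the image under \<open>S\<close> of the product measure
    indexed by \<open>Basis\<close>; coordinate \<open>i\<close> corresponds to the basis vector
    \<open>axis i 1\<close>.\<close>
  define S :: "(real ^ 'n \<Rightarrow> real) \<Rightarrow> real ^ 'n" where "S f = (\<Sum>b\<in>Basis. f b *\<^sub>R b)" for f
  have S_nth: "S f $ i = f (axis i 1)" for f i
    by (simp add: S_def cart_eq_inner_axis axis_in_Basis_iff inner_sum_left_Basis)
  have S_orthant: "S f \<in> orthant \<longleftrightarrow> (\<forall>b\<in>Basis. 0 < f b)" for f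
    by (auto simp: orthant_def S_nth Basis_vec_def)
  have [measurable]: "S \<in> measurable (Pi\<^sub>M Basis (\<lambda>_. lborel)) borel"
    unfolding S_def by measurable
  have int: "(\<integral>\<^sup>+x. h x \<partial>lborel) = (\<integral>\<^sup>+f. h (S f) \<partial>Pi\<^sub>M Basis (\<lambda>_. lborel))"
    if [measurable]: "h \<in> borel_measurable borel" for h :: "real ^ 'n \<Rightarrow> ennreal"
    by (subst lborel_eq) (simp add: nn_integral_distr S_def[symmetric])
  show ?thesis
    unfolding int[OF assms(1)] int[OF assms(2)] int[OF assms(3)]
  proof (rule prekopa_leindler_geometric_PiM)
    fix f g :: "real ^ 'n \<Rightarrow> real"
    assume pos: "\<And>b. b \<in> Basis \<Longrightarrow> 0 < f b" "\<And>b. b \<in> Basis \<Longrightarrow> 0 < g b"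
    have "u (S f) * v (S g) \<le> (w (\<chi> i. sqrt (S f $ i * S g $ i)))\<^sup>2"
      by (rule le) (use pos in \<open>auto simp: S_orthant\<close>)
    also have "(\<chi> i. sqrt (S f $ i * S g $ i)) = S (\<lambda>b\<in>Basis. sqrt (f b * g b))"
      by (simp add: vec_eq_iff S_nth axis_in_Basis_iff)
    finally show "u (S f) * v (S g) \<le> (w (S (\<lambda>b\<in>Basis. sqrt (f b * g b))))\<^sup>2" .
  qed (use 0 in \<open>force simp: S_orthant not_less\<close>)+
qed

section \<open>Midpoint convexity with a compactly supported perturbation\<close>

text \<open>Taylor's formula of order two for the even part of \<open>\<phi>\<close>, whose first
  derivative vanishes at 0. Symmetrising first yields one intermediate point \<open>t\<close> that
  serves both sides.\<close>

lemma midpoint_deficit_eq: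
  fixes \<phi> :: "real \<Rightarrow> real"
  assumes "\<And>t. (\<phi> has_real_derivative \<phi>' t) (at t)" "\<And>t. (\<phi>' has_real_derivative \<phi>'' t) (at t)"
  shows "\<exists>t. \<bar>t\<bar> \<le> 1 \<and> (\<phi> 1 + \<phi> (-1)) / 2 - \<phi> 0 = (\<phi>'' t + \<phi>'' (-t)) / 4"
proof -
  define D where "D m = (if m = 0 then (\<lambda>t. (\<phi> t + \<phi> (-t)) / 2) else if m = 1 then (\<lambda>t. (\<phi>' t - \<phi>' (-t)) / 2)
     else (\<lambda>t. (\<phi>'' t + \<phi>'' (-t)) / 2))" for m :: nat
  have "\<exists>t>0. t < 1 \<and> D 0 1 = (\<Sum>m<2. D m 0 / fact m * 1 ^ m) + D 2 t / fact 2 * 1 ^ 2"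
  proof (rule Maclaurin)
    show "\<forall>m t. m < 2 \<and> 0 \<le> t \<and> t \<le> 1 \<longrightarrow> (D m has_real_derivative D (Suc m) t) (at t)"
    proof (intro allI impI)
      fix m :: nat and t :: real assume "m < 2 \<and> 0 \<le> t \<and> t \<le> 1"
      then consider "m = 0" | "m = 1" by linarith
      then show "(D m has_real_derivative D (Suc m) t) (at t)"
      proof cases
        case 1
        then show ?thesis unfolding D_def
          by (auto intro!: derivative_eq_intros DERIV_chain2[of \<phi>, OF assms(1)] assms(1) simp: field_simps)
      next
        case 2
        then show ?thesis unfolding D_def
          by (auto intro!: derivative_eq_intros DERIV_chain2[of \<phi>', OF assms(2)] assms(2) simp: field_simps)
      qed
    qed
  qed auto
  then obtain t where "0 < t" "t < 1" "D 0 1 = (\<Sum>m<2. D m 0 / fact m * 1 ^ m) + D 2 t / fact 2 * 1 ^ 2"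
    by auto
  then show ?thesis
    by (intro exI[of _ t]) (simp add: D_def numeral_2_eq_2 field_simps)
qed

text \<open>The derivative of the deficit in the half-length \<open>L\<close> is
  \<open>\<phi>' (2 * L) - \<phi>' L\<close>, nonnegative by convexity. With one endpoint held
  fixed, a long step thus loses at least as much as a short one.\<close>

lemma midpoint_deficit_mono:
  fixes \<phi> :: "real \<Rightarrow> real"
  assumes d: "\<And>t. (\<phi> has_real_derivative \<phi>' t) (at t)" "\<And>t. (\<phi>' has_real_derivative \<phi>'' t) (at t)"
    and pos: "\<And>t. \<phi>'' t \<ge> 0" and L: "0 \<le> K" "K \<le> L"
  shows "(\<phi> 0 + \<phi> (2 * K)) / 2 - \<phi> K \<le> (\<phi> 0 + \<phi> (2 * L)) / 2 - \<phi> L"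
proof (rule DERIV_nonneg_imp_nondecreasing[OF L(2)])
  fix t assume t: "K \<le> t" "t \<le> L"
  have "\<phi>' t \<le> \<phi>' (2 * t)"
    by (rule DERIV_nonneg_imp_nondecreasing) (use t L pos d(2) in auto)
  moreover have "((\<lambda>L. (\<phi> 0 + \<phi> (2 * L)) / 2 - \<phi> L) has_real_derivative \<phi>' (2 * t) - \<phi>' t) (at t)"
    by (auto intro!: derivative_eq_intros DERIV_chain2[of \<phi>, OF d(1)] d(1))
  ultimately show "\<exists>y. ((\<lambda>L. (\<phi> 0 + \<phi> (2 * L)) / 2 - \<phi> L) has_real_derivative y) (at t) \<and> 0 \<le> y"
    by (intro exI[of _ "\<phi>' (2 * t) - \<phi>' t"]) auto
qed

text \<open>
  \<open>P\<close> and \<open>q\<close> are the first and second directional derivatives of \<open>U\<close>, and \<open>l\<close> is that of \<open>g\<close>.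
\<close>
locale convex_potential =
  fixes U g :: "'a :: euclidean_space \<Rightarrow> real" and P q l :: "'a \<Rightarrow> 'a \<Rightarrow> real" and S :: "'a set"
  assumes U: "((\<lambda>t. U (z + t *\<^sub>R h)) has_real_derivative P (z + t *\<^sub>R h) h) (at t)"
    and P: "((\<lambda>t. P (z + t *\<^sub>R h) h) has_real_derivative q (z + t *\<^sub>R h) h) (at t)"
    and g: "((\<lambda>t. g (z + t *\<^sub>R h)) has_real_derivative l (z + t *\<^sub>R h) h) (at t)"
    and q_cont: "continuous_on UNIV (\<lambda>(z, h). q z h)"
    and l_cont: "continuous_on UNIV (\<lambda>(z, h). l z h)"
    and q_scale: "q z (c *\<^sub>R h) = c\<^sup>2 * q z h"
    and l_scale: "l z (c *\<^sub>R h) = c * l z h"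
    and q_pos: "h \<noteq> 0 \<Longrightarrow> 0 < q z h"
    and g_cont: "continuous_on UNIV g"
    and S: "compact S" and g_supp: "z \<notin> S \<Longrightarrow> g z = 0"
begin

lemma q_nonneg: "0 \<le> q z h"
  using q_pos[of h z] q_scale[of z 0 h] by (cases "h = 0") auto

lemma deficit:
  "\<exists>t. \<bar>t\<bar> \<le> 1 \<and> (U (z + h) + U (z - h)) / 2 - U z = (q (z + t *\<^sub>R h) h + q (z - t *\<^sub>R h) h) / 4"
  using midpoint_deficit_eq[of "\<lambda>t. U (z + t *\<^sub>R h)", OF U P, simplified] by simp

lemma deficit_nonneg: "0 \<le> (U (z + h) + U (z - h)) / 2 - U z"
proof -
  obtain t where t: "(U (z + h) + U (z - h)) / 2 - U z = (q (z + t *\<^sub>R h) h + q (z - t *\<^sub>R h) h) / 4"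
    using deficit by blast
  show ?thesis unfolding t by (simp add: q_nonneg add_nonneg_nonneg)
qed

text \<open>By monotonicity in the step the deficit is at least that for half-length 1. The segment
  for that step runs from \<open>x\<close> to \<open>x - 2 *\<^sub>R e\<close> and stays within
  distance 2 of \<open>x\<close>, so the bound on \<open>q\<close> there is enough even if the other
  endpoint is far away.\<close>

lemma deficit_far:
  assumes L: "1 \<le> L" and bd: "\<And>p. dist x p \<le> 2 \<Longrightarrow> \<alpha> \<le> q p e" and e: "norm e = 1"
  shows "\<alpha> / 2 \<le> (U x + U (x - (2 * L) *\<^sub>R e)) / 2 - U (x - L *\<^sub>R e)"
proof -
  have "(U x + U (x - 2 *\<^sub>R e)) / 2 - U (x - e) \<le> (U x + U (x - (2 * L) *\<^sub>R e)) / 2 - U (x - L *\<^sub>R e)"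
    using midpoint_deficit_mono[of "\<lambda>t. U (x + t *\<^sub>R (- e))", OF U P, of 1 L] L q_nonneg
    by simp
  moreover have "\<alpha> / 2 \<le> (U x + U (x - 2 *\<^sub>R e)) / 2 - U (x - e)"
  proof -
    obtain t where t: "\<bar>t\<bar> \<le> 1"
      "(U (x - e + e) + U (x - e - e)) / 2 - U (x - e) = (q (x - e + t *\<^sub>R e) e + q (x - e - t *\<^sub>R e) e) / 4"
      using deficit[of "x - e" e] by blast
    have "x - (x - e + t *\<^sub>R e) = (1 - t) *\<^sub>R e" "x - (x - e - t *\<^sub>R e) = (1 + t) *\<^sub>R e"
      by (simp_all add: algebra_simps)
    then have "dist x (x - e + t *\<^sub>R e) \<le> 2" "dist x (x - e - t *\<^sub>R e) \<le> 2"
      using t(1) e unfolding dist_norm by auto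
    then have "\<alpha> \<le> q (x - e + t *\<^sub>R e) e" "\<alpha> \<le> q (x - e - t *\<^sub>R e) e"
      by (auto intro: bd)
    then have "\<alpha> / 2 \<le> (U (x - e + e) + U (x - e - e)) / 2 - U (x - e)"
      unfolding t(2) by (simp add: field_simps)
    then show ?thesis by (simp add: scaleR_2 diff_diff_add)
  qed
  ultimately show ?thesis by (rule order_trans[rotated])
qed

text \<open>
  For \<open>h\<close> of norm at least 1 the deficit is bounded below, and otherwise it grows like
  \<open>(norm h)\<^sup>2\<close>, so the left-hand side can only be positive if \<open>h = O(\<epsilon>)\<close>; there the second
  order expansion applies.
\<close>
lemma perturbation_le_deficit:
  assumes "\<eta> > 0"
  shows "\<exists>\<epsilon>0>0. \<forall>\<epsilon> z h. 0 < \<epsilon> \<longrightarrow> \<epsilon> < \<epsilon>0 \<longrightarrow> 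
    \<epsilon> / 2 * (g (z + h) - g (z - h)) - ((U (z + h) + U (z - h)) / 2 - U z) \<le> 0 \<or>
    \<epsilon> / 2 * (g (z + h) - g (z - h)) - ((U (z + h) + U (z - h)) / 2 - U z)
      \<le> \<epsilon>\<^sup>2 / 2 * (2 * l z (h /\<^sub>R \<epsilon>) - q z (h /\<^sub>R \<epsilon>) + \<eta>)"
proof -
  \<comment> \<open>The radius 2 makes \<open>S2\<close> contain the whole segment from
    \<open>z - h\<close> to \<open>z + h\<close> once one endpoint is in \<open>S\<close> and
    \<open>norm h \<le> 1\<close>, and also the segments used in \<open>deficit_far\<close>.\<close>
  define S2 where "S2 = {x + y | x y. x \<in> S \<and> y \<in> cball 0 2}"
  have S2: "compact S2" unfolding S2_def by (intro compact_sums S compact_cball)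
  have S2I: "p \<in> S2" if "x \<in> S" "dist x p \<le> 2" for x p
    unfolding S2_def using that by (intro CollectI exI[of _ x] exI[of _ "p - x"]) (auto simp: dist_norm norm_minus_commute)
  have q_cont': "continuous_on X (\<lambda>p. q (fst p) (snd p))" for X
    using continuous_on_subset[OF q_cont, of X] by (simp add: case_prod_unfold)
  have l_cont': "continuous_on X (\<lambda>p. l (fst p) (snd p))" for X
    using continuous_on_subset[OF l_cont, of X] by (simp add: case_prod_unfold)
  obtain M where M: "M > 0" "\<And>x. \<bar>g x\<bar> \<le> M"
  proof -
    have "compact (g ` S)"
      by (intro compact_continuous_image S continuous_on_subset[OF g_cont]) auto
    then obtain M where M: "M > 0" "\<And>x. x \<in> S \<Longrightarrow> \<bar>g x\<bar> \<le> M"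
      using bounded_pos[THEN iffD1, OF compact_imp_bounded] by force
    have "\<bar>g x\<bar> \<le> M" for x using M g_supp[of x] by (cases "x \<in> S") auto
    with M(1) that show ?thesis by blast
  qed
  \<comment> \<open>\<open>\<alpha>\<close> is a positive minimum of \<open>q\<close> over
    \<open>S2\<close> and the unit sphere, extended to all \<open>h\<close> by homogeneity.
    \<open>L\<close> below is the corresponding bound for the linear form.\<close>
  obtain \<alpha> where \<alpha>: "\<alpha> > 0" "\<And>p h. p \<in> S2 \<Longrightarrow> \<alpha> * (norm h)\<^sup>2 \<le> q p h"
  proof -
    have "\<exists>\<alpha>>0. \<forall>p\<in>S2. \<forall>e. norm e = 1 \<longrightarrow> \<alpha> \<le> q p e"
    proof (cases "S2 \<times> sphere (0::'a) 1 = {}")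
      case False
      have "compact (S2 \<times> sphere (0::'a) 1)" by (intro compact_Times S2 compact_sphere)
      from continuous_attains_inf[OF this False q_cont'] obtain p\<^sub>0
        where "p\<^sub>0 \<in> S2 \<times> sphere 0 1" "\<forall>p\<in>S2 \<times> sphere 0 1. q (fst p\<^sub>0) (snd p\<^sub>0) \<le> q (fst p) (snd p)"
        by blast
      then show ?thesis
        by (intro exI[of _ "q (fst p\<^sub>0) (snd p\<^sub>0)"]) (force intro!: q_pos)
    next
      case True
      then have "S2 = {} \<or> (\<forall>e::'a. norm e \<noteq> 1)" by (auto simp: sphere_def)
      then show ?thesis by (intro exI[of _ 1]) auto
    qed
    then obtain \<alpha> where \<alpha>: "\<alpha> > 0" "\<And>p e. p \<in> S2 \<Longrightarrow> norm e = 1 \<Longrightarrow> \<alpha> \<le> q p e" by blast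
    have "\<alpha> * (norm h)\<^sup>2 \<le> q p h" if "p \<in> S2" for p h
    proof (cases "h = 0")
      case False
      have "(norm h)\<^sup>2 * \<alpha> \<le> (norm h)\<^sup>2 * q p (h /\<^sub>R norm h)"
        using False by (intro mult_left_mono \<alpha>(2) that) auto
      also have "\<dots> = q p h" using False by (simp flip: q_scale)
      finally show ?thesis by (simp add: mult.commute)
    qed (use q_nonneg in auto)
    with \<alpha>(1) that show ?thesis by blast
  qed
  obtain L where L: "L > 0" "\<And>p h. p \<in> S2 \<Longrightarrow> l p h \<le> L * norm h"
  proof -
    have "compact ((\<lambda>p. l (fst p) (snd p)) ` (S2 \<times> sphere (0::'a) 1))"
      by (intro compact_continuous_image l_cont' compact_Times S2 compact_sphere)
    then obtain L where L: "L > 0" "\<And>x. x \<in> (\<lambda>p. l (fst p) (snd p)) ` (S2 \<times> sphere (0::'a) 1) \<Longrightarrow> \<bar>x\<bar> \<le> L"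
      using bounded_pos[THEN iffD1, OF compact_imp_bounded] by force
    have L': "l p e \<le> L" if "p \<in> S2" "norm e = 1" for p e
      using L(2)[of "l p e"] that by force
    have "l p h \<le> L * norm h" if "p \<in> S2" for p h
    proof (cases "h = 0")
      case True
      then show ?thesis using l_scale[of p 0 h] by simp
    next
      case False
      have "norm h * l p (h /\<^sub>R norm h) \<le> norm h * L"
        using False by (intro mult_left_mono L' that) auto
      moreover have "norm h * l p (h /\<^sub>R norm h) = l p h" using False by (simp flip: l_scale)
      ultimately show ?thesis by (simp add: mult.commute)
    qed
    with L(1) that show ?thesis by blast
  qed
  \<comment> \<open>Beyond this radius the quadratic loss
    \<open>\<alpha> * (norm k)\<^sup>2 / 2\<close> exceeds the linear gain
    \<open>L * norm k\<close>, so uniform continuity is needed only for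
    \<open>norm k \<le> R\<close>.\<close>
  define R where "R = 2 * L / \<alpha>"
  have R: "R > 0" using L \<alpha> by (simp add: R_def)
  \<comment> \<open>The errors add up to \<open>\<eta> / 4\<close> from \<open>l\<close> and
    \<open>(\<eta> / 2 + \<eta> / 2) / 4\<close> from the two values of \<open>q\<close>, in total
    the \<open>\<eta> / 2\<close> that the claim allows.\<close>
  obtain \<delta> where \<delta>: "\<delta> > 0" 
     "\<And>p z k. p \<in> S2 \<Longrightarrow> z \<in> S2 \<Longrightarrow> dist p z < \<delta> \<Longrightarrow> norm k \<le> R \<Longrightarrow> l p k \<le> l z k + \<eta> / 4"
     "\<And>p z k. p \<in> S2 \<Longrightarrow> z \<in> S2 \<Longrightarrow> dist p z < \<delta> \<Longrightarrow> norm k \<le> R \<Longrightarrow> q z k \<le> q p k + \<eta> / 2"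
  proof -
    have K: "compact (S2 \<times> cball (0::'a) R)" by (intro compact_Times S2 compact_cball)
    obtain d1 where d1: "d1 > 0" "\<And>x y. x \<in> S2 \<times> cball 0 R \<Longrightarrow> y \<in> S2 \<times> cball 0 R \<Longrightarrow> dist y x < d1 \<Longrightarrow>
        dist (l (fst y) (snd y)) (l (fst x) (snd x)) < \<eta> / 4"
      using compact_uniformly_continuous[OF l_cont' K] assms unfolding uniformly_continuous_on_def
      by (metis divide_pos_pos zero_less_numeral)
    obtain d2 where d2: "d2 > 0" "\<And>x y. x \<in> S2 \<times> cball 0 R \<Longrightarrow> y \<in> S2 \<times> cball 0 R \<Longrightarrow> dist y x < d2 \<Longrightarrow>
        dist (q (fst y) (snd y)) (q (fst x) (snd x)) < \<eta> / 2"
      using compact_uniformly_continuous[OF q_cont' K] assms unfolding uniformly_continuous_on_def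
      by (metis divide_pos_pos zero_less_numeral)
    show ?thesis
    proof (rule that[of "min d1 d2"])
      fix p z k assume *: "p \<in> S2" "z \<in> S2" "dist p z < min d1 d2" "norm (k::'a) \<le> R"
      show "l p k \<le> l z k + \<eta> / 4"
      proof -
        have "dist (l p k) (l z k) < \<eta> / 4"
          using d1(2)[of "(z, k)" "(p, k)"] * by (simp add: dist_Pair_Pair)
        then show ?thesis unfolding dist_real_def abs_less_iff by linarith
      qed
      show "q z k \<le> q p k + \<eta> / 2"
      proof -
        have "dist (q p k) (q z k) < \<eta> / 2"
          using d2(2)[of "(z, k)" "(p, k)"] * by (simp add: dist_Pair_Pair)
        then show ?thesis unfolding dist_real_def abs_less_iff by linarith
      qed
    qed (use d1 d2 in auto)
  qed
  \<comment> \<open>The first bound gives \<open>\<epsilon> * M < \<alpha> / 2\<close>, which lets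
    the deficit win when \<open>norm h \<ge> 1\<close>; the second gives
    \<open>norm h \<le> \<epsilon> * R < \<delta>\<close> in the range where the expansion is
    used.\<close>
  define \<epsilon>0 where "\<epsilon>0 = min (\<alpha> / (2 * M)) (\<delta> / (2 * R))"
  have "\<epsilon>0 > 0" using \<alpha> M \<delta> R by (simp add: \<epsilon>0_def)
  \<comment> \<open>The bound is a disjunction because the second right-hand side becomes very
    negative for large \<open>h\<close>, while the true deficit may grow more slowly.\<close>
  moreover have "\<epsilon> / 2 * (g (z + h) - g (z - h)) - ((U (z + h) + U (z - h)) / 2 - U z) \<le> 0 \<or>
    \<epsilon> / 2 * (g (z + h) - g (z - h)) - ((U (z + h) + U (z - h)) / 2 - U z)
      \<le> \<epsilon>\<^sup>2 / 2 * (2 * l z (h /\<^sub>R \<epsilon>) - q z (h /\<^sub>R \<epsilon>) + \<eta>)"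
    if \<epsilon>: "0 < \<epsilon>" "\<epsilon> < \<epsilon>0" for \<epsilon> z h
  proof (cases "z + h \<in> S \<or> z - h \<in> S")
    case False
    then show ?thesis using g_supp deficit_nonneg[of z h] by auto
  next
    case True
    show ?thesis
    proof (cases "norm h \<ge> 1")
      case True
      define e where "e = h /\<^sub>R norm h"
      have "norm h \<noteq> 0" using True by linarith
      then have e: "norm e = 1" "norm h *\<^sub>R e = h" unfolding e_def by simp_all
      \<comment> \<open>Whichever endpoint lies in \<open>S\<close> is the base point of
        \<open>deficit_far\<close>, with direction \<open>e\<close> or \<open>- e\<close> towards
        the other one.\<close>
      have "\<alpha> / 2 \<le> (U (z + h) + U (z - h)) / 2 - U z"
        using \<open>z + h \<in> S \<or> z - h \<in> S\<close>
      proof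
        assume "z + h \<in> S"
        then have "\<alpha> / 2 \<le> (U (z + h) + U (z + h - (2 * norm h) *\<^sub>R e)) / 2 - U (z + h - norm h *\<^sub>R e)"
          using \<alpha>(2)[of _ e] e by (intro deficit_far True) (auto dest: S2I)
        moreover have "(2 * norm h) *\<^sub>R e = 2 *\<^sub>R h" using e(2) by (metis scaleR_scaleR)
        ultimately show ?thesis by (simp add: e scaleR_2 algebra_simps)
      next
        assume "z - h \<in> S"
        then have "\<alpha> / 2 \<le> (U (z - h) + U (z - h - (2 * norm h) *\<^sub>R (- e))) / 2 - U (z - h - norm h *\<^sub>R (- e))"
          using \<alpha>(2)[of _ "- e"] e by (intro deficit_far True) (auto dest: S2I)
        moreover have "(2 * norm h) *\<^sub>R e = 2 *\<^sub>R h" using e(2) by (metis scaleR_scaleR)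
        ultimately show ?thesis by (simp add: e scaleR_2 algebra_simps)
      qed
      moreover have "\<epsilon> / 2 * (g (z + h) - g (z - h)) \<le> \<epsilon> / 2 * (2 * M)"
        using M(2)[of "z + h"] M(2)[of "z - h"] \<epsilon> by (intro mult_left_mono) auto
      moreover have "\<epsilon> * M < \<alpha> / 2"
        using \<epsilon> M by (simp add: \<epsilon>0_def field_simps)
      ultimately show ?thesis by auto
    next
      case False
      have inS2: "z + t *\<^sub>R h \<in> S2" if "\<bar>t\<bar> \<le> 1" for t
      proof -
        have "(z + h) - (z + t *\<^sub>R h) = (1 - t) *\<^sub>R h" "(z - h) - (z + t *\<^sub>R h) = - ((1 + t) *\<^sub>R h)"
          by (simp_all add: algebra_simps)
        then have "dist (z + h) (z + t *\<^sub>R h) = \<bar>1 - t\<bar> * norm h" "dist (z - h) (z + t *\<^sub>R h) = \<bar>1 + t\<bar> * norm h"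
          unfolding dist_norm by simp_all
        moreover have "\<bar>1 - t\<bar> * norm h \<le> 2 * 1" "\<bar>1 + t\<bar> * norm h \<le> 2 * 1"
          using that False by (intro mult_mono; simp)+
        ultimately show ?thesis
          using \<open>z + h \<in> S \<or> z - h \<in> S\<close> S2I by auto
      qed
      obtain s where s: "\<bar>s\<bar> \<le> 1" "g (z + h) - g (z - h) = 2 * l (z + s *\<^sub>R h) h"
      proof -
        have "\<exists>s. -1 < s \<and> s < 1 \<and> g (z + 1 *\<^sub>R h) - g (z + (-1) *\<^sub>R h) = (1 - (-1)) * l (z + s *\<^sub>R h) h"
          by (rule MVT2) (use g in auto)
        then show ?thesis using that by force
      qed
      obtain t where t: "\<bar>t\<bar> \<le> 1" "(U (z + h) + U (z - h)) / 2 - U z = (q (z + t *\<^sub>R h) h + q (z - t *\<^sub>R h) h) / 4"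
        using deficit[of z h] by blast
      \<comment> \<open>Balancing a gain of order \<open>\<epsilon> * norm h\<close> against a loss
        of order \<open>(norm h)\<^sup>2\<close> makes \<open>\<epsilon>\<close> the natural unit
        for \<open>h\<close>.\<close>
      define k where "k = h /\<^sub>R \<epsilon>"
      have h: "h = \<epsilon> *\<^sub>R k" using \<epsilon> by (simp add: k_def)
      have in3: "z \<in> S2" "z + s *\<^sub>R h \<in> S2" "z + t *\<^sub>R h \<in> S2" "z - t *\<^sub>R h \<in> S2"
        using inS2[of 0] inS2[of s] inS2[of t] inS2[of "-t"] s t by auto
      have eq: "\<epsilon> / 2 * (g (z + h) - g (z - h)) - ((U (z + h) + U (z - h)) / 2 - U z)
          = \<epsilon>\<^sup>2 * (l (z + s *\<^sub>R h) k - (q (z + t *\<^sub>R h) k + q (z - t *\<^sub>R h) k) / 4)"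
        unfolding s t by (subst (2 4 6) h) (simp add: q_scale l_scale power2_eq_square algebra_simps)
      show ?thesis
      proof (cases "norm k \<le> R")
        case True
        have small: "norm h < \<delta>"
        proof -
          have "norm h \<le> \<epsilon> * R" using \<epsilon> True by (simp add: h mult_left_mono)
          also have "\<dots> < \<delta> / (2 * R) * R" using \<epsilon> R by (intro mult_strict_right_mono) (auto simp: \<epsilon>0_def)
          also have "\<dots> \<le> \<delta>" using R \<delta> by simp
          finally show ?thesis .
        qed
        have d: "dist (z + r *\<^sub>R h) z < \<delta>" if "\<bar>r\<bar> \<le> 1" for r
          using mult_right_mono[OF that, of "norm h"] small by (simp add: dist_norm)
        have "l (z + s *\<^sub>R h) k \<le> l z k + \<eta> / 4"
          by (intro \<delta>(2) in3 d s True)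
        moreover have "q z k \<le> q (z + t *\<^sub>R h) k + \<eta> / 2"
          by (intro \<delta>(3) in3 d t True)
        moreover have "q z k \<le> q (z - t *\<^sub>R h) k + \<eta> / 2"
          using d[of "- t"] t by (intro \<delta>(3) in3 True) auto
        ultimately have "l (z + s *\<^sub>R h) k - (q (z + t *\<^sub>R h) k + q (z - t *\<^sub>R h) k) / 4 \<le> (2 * l z k - q z k + \<eta>) / 2"
          by (simp add: field_simps)
        then have "\<epsilon>\<^sup>2 * (l (z + s *\<^sub>R h) k - (q (z + t *\<^sub>R h) k + q (z - t *\<^sub>R h) k) / 4)
           \<le> \<epsilon>\<^sup>2 * ((2 * l z k - q z k + \<eta>) / 2)"
          by (intro mult_left_mono) auto
        then show ?thesis unfolding eq k_def[symmetric] by simp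
      next
        case False
        have "l (z + s *\<^sub>R h) k \<le> L * norm k" by (intro L in3)
        moreover have "(\<alpha> * norm k) * norm k / 2 \<le> (q (z + t *\<^sub>R h) k + q (z - t *\<^sub>R h) k) / 4"
          using \<alpha>(2)[OF in3(3), of k] \<alpha>(2)[OF in3(4), of k] by (simp add: power2_eq_square)
        moreover have "(2 * L) * norm k \<le> (\<alpha> * norm k) * norm k"
          using False \<alpha> by (intro mult_right_mono) (auto simp: R_def field_simps)
        ultimately have "l (z + s *\<^sub>R h) k - (q (z + t *\<^sub>R h) k + q (z - t *\<^sub>R h) k) / 4 \<le> 0"
          by (simp add: field_simps)
        then have "\<epsilon>\<^sup>2 * (l (z + s *\<^sub>R h) k - (q (z + t *\<^sub>R h) k + q (z - t *\<^sub>R h) k) / 4) \<le> 0"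
          by (intro mult_nonneg_nonpos) auto
        then show ?thesis unfolding eq by blast
      qed
    qed
  qed
  ultimately show ?thesis by blast
qed

end

section \<open>Logarithmic coordinates on the orthant\<close>

lemma pos_def_invertible:
  fixes A :: "real ^ 'n ^ 'n"
  assumes "pos_def A"
  shows "invertible A"
proof -
  have "x = 0" if "A *v x = 0" for x
    using assms that unfolding pos_def_def by force
  then show ?thesis
    unfolding invertible_left_inverse matrix_left_invertible_ker by blast
qed

lemma matrix_inv_vector_mult:
  fixes A :: "real ^ 'n ^ 'n"
  assumes "invertible A"
  shows "A *v (matrix_inv A *v b) = b"
proof -
  have "A ** matrix_inv A = mat 1"
    using someI_ex[OF assms[unfolded invertible_def]] unfolding matrix_inv_def by blast
  then show ?thesis by (simp add: matrix_vector_mul_assoc)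
qed

lemma pos_def_nonneg: "pos_def A \<Longrightarrow> 0 \<le> v \<bullet> (A *v v)"
  unfolding pos_def_def by (cases "v = 0") (auto simp: less_imp_le)

text \<open>Expanding \<open>0 \<le> (w - u) \<bullet> (A *v (w - u))\<close> at
  \<open>u = matrix_inv A *v b\<close>, the maximiser of the left-hand side. The case
  \<open>w = 0\<close> also shows that the inverse form is nonnegative.\<close>

lemma pos_def_young:
  fixes A :: "real ^ 'n ^ 'n"
  assumes A: "pos_def A"
  shows "2 * (b \<bullet> w) - w \<bullet> (A *v w) \<le> b \<bullet> (matrix_inv A *v b)"
proof -
  define u where "u = matrix_inv A *v b"
  have Au: "A *v u = b"
    unfolding u_def by (rule matrix_inv_vector_mult[OF pos_def_invertible[OF A]])
  have "u \<bullet> (A *v w) = b \<bullet> w"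
  proof -
    have "u \<bullet> (A *v w) = (u v* A) \<bullet> w"
      by (simp add: dot_lmul_matrix)
    also have "u v* A = A *v u"
      using A transpose_matrix_vector[of A u] by (simp add: pos_def_def)
    finally show ?thesis by (simp add: Au)
  qed
  moreover have "0 \<le> (w - u) \<bullet> (A *v (w - u))"
    by (rule pos_def_nonneg[OF A])
  ultimately show ?thesis
    unfolding u_def[symmetric]
    by (simp add: matrix_vector_mult_diff_distrib inner_diff_left inner_diff_right Au inner_commute)
qed

lemma continuous_on_det:
  fixes A :: "'a :: topological_space \<Rightarrow> real ^ 'n ^ 'n"
  assumes "\<And>i j. continuous_on S (\<lambda>x. A x $ i $ j)"
  shows "continuous_on S (\<lambda>x. det (A x))"
  unfolding det_def by (intro continuous_intros assms)

text \<open>Cramer's rule writes each component of the solution as a quotient of determinants, which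
  are polynomials in the entries.\<close>

lemma continuous_on_matrix_inv_vector:
  fixes A :: "'a :: topological_space \<Rightarrow> real ^ 'n ^ 'n" and b :: "'a \<Rightarrow> real ^ 'n"
  assumes A: "\<And>i j. continuous_on S (\<lambda>x. A x $ i $ j)" and b: "\<And>i. continuous_on S (\<lambda>x. b x $ i)"
    and inv: "\<And>x. x \<in> S \<Longrightarrow> invertible (A x)"
  shows "continuous_on S (\<lambda>x. matrix_inv (A x) *v b x)"
proof -
  let ?B = "\<lambda>k x. \<chi> i j. if j = k then b x $ i else A x $ i $ j"
  have det: "det (A x) \<noteq> 0" if "x \<in> S" for x
    using inv[OF that] by (simp add: invertible_det_nz)
  have "continuous_on S (\<lambda>x. \<chi> k. det (?B k x) / det (A x))"
  proof (intro continuous_on_vec_lambda continuous_on_divide continuous_on_det)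
    fix k i j show "continuous_on S (\<lambda>x. ?B k x $ i $ j)"
      using A b by (cases "j = k") auto
  qed (use A det in auto)
  moreover have "matrix_inv (A x) *v b x = (\<chi> k. det (?B k x) / det (A x))" if "x \<in> S" for x
    using matrix_inv_vector_mult[OF inv[OF that], of "b x"] cramer[OF det[OF that]] by blast
  ultimately show ?thesis
    by (simp cong: continuous_on_cong)
qed

section \<open>Derivatives along exponential curves\<close>

lemma has_derivative_grad:
  fixes f :: "real ^ 'n \<Rightarrow> real"
  assumes "f differentiable at x"
  shows "(f has_derivative (\<lambda>v. grad f x \<bullet> v)) (at x)"
proof -
  interpret F: linear "frechet_derivative f (at x)"
    by (rule linear_frechet_derivative[OF assms])
  have "frechet_derivative f (at x) v = grad f x \<bullet> v" for v
  proof -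
    have "frechet_derivative f (at x) v = frechet_derivative f (at x) (\<Sum>i\<in>UNIV. v $ i *\<^sub>R axis i 1)"
      by (simp add: basis_expansion[of v, unfolded scalar_mult_eq_scaleR])
    also have "\<dots> = (\<Sum>i\<in>UNIV. v $ i * partial i f x)"
      by (simp add: F.sum F.scaleR partial_def)
    finally show ?thesis by (simp add: inner_vec_def grad_def mult.commute)
  qed
  then have "frechet_derivative f (at x) = (\<lambda>v. grad f x \<bullet> v)" by auto
  then show ?thesis using assms frechet_derivative_works by metis
qed

lemma open_orthant: "open (orthant :: (real ^ 'n) set)"
proof -
  have "orthant = (\<Inter>i. {x :: real ^ 'n. 0 < x $ i})" by (auto simp: orthant_def)
  also have "open \<dots>" by (intro open_INT ballI open_Collect_less continuous_intros) auto
  finally show ?thesis .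
qed

lemma Ck_on_Suc: "Ck_on (Suc k) S f \<Longrightarrow> Ck_on k S f"
proof (induction k arbitrary: f)
  case 0
  then show ?case
    by (auto intro!: continuous_at_imp_continuous_on differentiable_imp_continuous_within)
qed auto

definition expv :: "real ^ 'n \<Rightarrow> real ^ 'n" where
  "expv z = (\<chi> i. exp (z $ i))"

definition lnv :: "real ^ 'n \<Rightarrow> real ^ 'n" where
  "lnv x = (\<chi> i. ln (x $ i))"

text \<open>For \<open>x = expv z\<close> this is the derivative of \<open>expv\<close> at
  \<open>z\<close> applied to \<open>h\<close>: it turns a displacement in logarithmic coordinates
  into a velocity on the orthant.\<close>

definition scale_by :: "real ^ 'n \<Rightarrow> real ^ 'n \<Rightarrow> real ^ 'n" where
  "scale_by x h = (\<chi> i. x $ i * h $ i)"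

lemma expv_orthant [simp]: "expv z \<in> orthant"
  by (simp add: expv_def orthant_def)

lemma expv_lnv: "x \<in> orthant \<Longrightarrow> expv (lnv x) = x"
  by (simp add: expv_def lnv_def orthant_def vec_eq_iff)

lemma lnv_expv: "lnv (expv z) = z"
  by (simp add: expv_def lnv_def vec_eq_iff)

lemma continuous_on_expv [continuous_intros]: "continuous_on S f \<Longrightarrow> continuous_on S (\<lambda>x. expv (f x))"
  unfolding expv_def by (intro continuous_intros)

lemma continuous_on_lnv: "S \<subseteq> orthant \<Longrightarrow> continuous_on S lnv"
  unfolding lnv_def by (intro continuous_intros) (auto simp: orthant_def subset_iff less_le)

lemma expv_curve_derivative:
  fixes z h :: "real ^ 'n"
  shows "((\<lambda>t. expv (z + t *\<^sub>R h)) has_vector_derivative scale_by (expv (z + t *\<^sub>R h)) h) (at t)"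
  unfolding has_vector_derivative_def
proof (subst has_derivative_componentwise_within, intro ballI)
  fix b :: "real ^ 'n" assume "b \<in> Basis"
  then obtain i where b: "b = axis i 1" by (auto simp: Basis_vec_def)
  have "((\<lambda>t. exp (z $ i + t * h $ i)) has_real_derivative exp (z $ i + t * h $ i) * h $ i) (at t)"
    by (auto intro!: derivative_eq_intros)
  then have "((\<lambda>t. expv (z + t *\<^sub>R h) \<bullet> b) has_derivative (*) (exp (z $ i + t * h $ i) * h $ i)) (at t)"
    by (simp add: has_field_derivative_def b inner_axis expv_def)
  then show "((\<lambda>t. expv (z + t *\<^sub>R h) \<bullet> b) has_derivative
      (\<lambda>s. s *\<^sub>R scale_by (expv (z + t *\<^sub>R h)) h \<bullet> b)) (at t)"
    by (rule has_derivative_eq_rhs) (auto simp: b inner_axis expv_def scale_by_def)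
qed

lemma DERIV_along_expv_curve:
  fixes f :: "real ^ 'n \<Rightarrow> real"
  assumes "\<And>x. x \<in> orthant \<Longrightarrow> f differentiable at x"
  shows "((\<lambda>t. f (expv (z + t *\<^sub>R h))) has_real_derivative
    grad f (expv (z + t *\<^sub>R h)) \<bullet> scale_by (expv (z + t *\<^sub>R h)) h) (at t)"
proof -
  have "((f \<circ> (\<lambda>t. expv (z + t *\<^sub>R h))) has_vector_derivative
      grad f (expv (z + t *\<^sub>R h)) \<bullet> scale_by (expv (z + t *\<^sub>R h)) h) (at t)"
    by (rule vector_derivative_diff_chain_within[OF expv_curve_derivative
          has_derivative_at_withinI[OF has_derivative_grad[OF assms[OF expv_orthant]]]])
  then show ?thesis
    by (simp add: has_real_derivative_iff_has_vector_derivative o_def)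
qed

text \<open>The right-hand side is what the product rule gives for the second derivative of
  \<open>V\<close> along \<open>expv (z + t *\<^sub>R h)\<close>. The diagonal term of the curvature
  comes from the acceleration of that curve: \<open>x $ i * (h $ i)\<^sup>2\<close> is the squared
  velocity divided by \<open>x $ i\<close>.\<close>

lemma curvature_form:
  fixes V :: "real ^ 'n \<Rightarrow> real"
  assumes "x \<in> orthant"
  shows "scale_by x h \<bullet> (curvature V x *v scale_by x h)
    = (\<Sum>i\<in>UNIV. (grad (partial i V) x \<bullet> scale_by x h) * (x $ i * h $ i) + partial i V x * (x $ i * h $ i * h $ i))"
proof -
  have x: "x $ i \<noteq> 0" for i using assms by (auto simp: orthant_def less_le)
  let ?w = "\<lambda>i. x $ i * h $ i"
  have diag: "(\<Sum>j\<in>UNIV. (a j + (if i = j then b else 0)) * c j) = (\<Sum>j\<in>UNIV. a j * c j) + b * c i"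
    for a c :: "'n \<Rightarrow> real" and b i
  proof -
    have "(a j + (if i = j then b else 0)) * c j = a j * c j + (if i = j then b * c j else 0)" for j
      by (simp add: distrib_right)
    then show ?thesis by (simp add: sum.distrib)
  qed
  have "scale_by x h \<bullet> (curvature V x *v scale_by x h)
     = (\<Sum>i\<in>UNIV. ?w i * (\<Sum>j\<in>UNIV. (partial i (partial j V) x + (if i = j then partial i V x / x $ i else 0)) * ?w j))"
    by (simp add: inner_vec_def scale_by_def matrix_vector_mult_def curvature_def hess_def diag_mat_def cong: if_cong)
  also have "\<dots> = (\<Sum>i\<in>UNIV. ?w i * ((\<Sum>j\<in>UNIV. partial i (partial j V) x * ?w j) + partial i V x / x $ i * ?w i))"
    unfolding diag ..
  also have "\<dots> = (\<Sum>i\<in>UNIV. (\<Sum>j\<in>UNIV. partial i (partial j V) x * ?w i * ?w j) + partial i V x * (x $ i * h $ i * h $ i))"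
    using x by (intro sum.cong refl) (simp add: distrib_left sum_distrib_left mult_ac)
  also have "\<dots> = (\<Sum>i\<in>UNIV. \<Sum>j\<in>UNIV. partial i (partial j V) x * ?w i * ?w j)
      + (\<Sum>i\<in>UNIV. partial i V x * (x $ i * h $ i * h $ i))"
    by (rule sum.distrib)
  \<comment> \<open>Relabelling the indices replaces an appeal to the symmetry of second
    derivatives.\<close>
  also have "(\<Sum>i\<in>UNIV. \<Sum>j\<in>UNIV. partial i (partial j V) x * ?w i * ?w j)
      = (\<Sum>j\<in>UNIV. \<Sum>i\<in>UNIV. partial i (partial j V) x * ?w i * ?w j)"
    by (rule sum.swap)
  also have "\<dots> = (\<Sum>i\<in>UNIV. (grad (partial i V) x \<bullet> scale_by x h) * ?w i)"
    by (simp add: inner_vec_def grad_def scale_by_def sum_distrib_left sum_distrib_right mult_ac)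
  finally show ?thesis by (simp add: sum.distrib)
qed

lemma continuous_on_compose_expv:
  fixes f :: "real ^ 'n \<Rightarrow> real"
  assumes "continuous_on orthant f" "continuous_on S g"
  shows "continuous_on S (\<lambda>x. f (expv (g x)))"
  by (rule continuous_on_compose2[OF assms(1)]) (auto intro!: continuous_intros assms)

lemma grad_inner_scale_by: "grad f x \<bullet> scale_by x h = (\<Sum>i\<in>UNIV. partial i f x * (x $ i * h $ i))"
  by (simp add: inner_vec_def grad_def scale_by_def)

lemma DERIV_expv_nth:
  "((\<lambda>t. expv (z + t *\<^sub>R h) $ i) has_real_derivative expv (z + t *\<^sub>R h) $ i * h $ i) (at t)"
  unfolding expv_def by (auto intro!: derivative_eq_intros)

text \<open>Up to a factor 2, this is the logarithm of the Prekopa--Leindler hypothesis. The bound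
  must depend on the midpoint \<open>m\<close> only, so the displacement is eliminated by
  \<open>pos_def_young\<close>; \<open>\<eta>\<close> absorbs the errors of the expansion.\<close>

lemma pointwise_infimal_convolution:
  fixes V f :: "real ^ 'n \<Rightarrow> real"
  assumes V: "Ck_on (Suc (Suc 0)) orthant V" and f: "Ck_on (Suc 0) orthant f"
    and C: "compact C" "C \<subseteq> orthant" "\<And>x. x \<in> orthant - C \<Longrightarrow> f x = 0"
    and K: "\<And>x. x \<in> orthant \<Longrightarrow> pos_def (curvature V x)"
    and \<eta>: "\<eta> > 0"
  shows "\<exists>\<epsilon>0>0. \<forall>\<epsilon> x y. 0 < \<epsilon> \<longrightarrow> \<epsilon> < \<epsilon>0 \<longrightarrow> x \<in> orthant \<longrightarrow> y \<in> orthant \<longrightarrow>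
    (let m = \<chi> i. sqrt (x $ i * y $ i) in
     \<epsilon> / 2 * (f x - f y) - ((V x + V y) / 2 - V m)
     \<le> \<epsilon>\<^sup>2 / 2 * (grad f m \<bullet> (matrix_inv (curvature V m) *v grad f m) + \<eta>))"
proof -
  have Vd: "\<And>x. x \<in> orthant \<Longrightarrow> V differentiable at x"
    and Vdd: "\<And>x i. x \<in> orthant \<Longrightarrow> partial i V differentiable at x"
    and Vddc: "\<And>i j. continuous_on orthant (partial i (partial j V))"
    and fd: "\<And>x. x \<in> orthant \<Longrightarrow> f differentiable at x"
    and fdc: "\<And>i. continuous_on orthant (partial i f)"
    using V f by auto
  have Vdc: "continuous_on orthant (partial i V)" for i
    using Vdd by (auto intro!: continuous_at_imp_continuous_on differentiable_imp_continuous_within)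
  have fc: "continuous_on orthant f"
    using fd by (auto intro!: continuous_at_imp_continuous_on differentiable_imp_continuous_within)
  define P where "P z h = grad V (expv z) \<bullet> scale_by (expv z) h" for z h
  define q where "q z h = scale_by (expv z) h \<bullet> (curvature V (expv z) *v scale_by (expv z) h)" for z h
  define l where "l z h = grad f (expv z) \<bullet> scale_by (expv z) h" for z h
  have scale_scale: "scale_by x (c *\<^sub>R h) = c *\<^sub>R scale_by x h" for x h :: "real ^ 'n" and c
    by (simp add: scale_by_def vec_eq_iff)
  \<comment> \<open>A linear function has zero midpoint deficit, so \<open>V (expv z)\<close> can
    serve as the potential without the linear term of \<open>W\<close>.\<close>
  interpret convex_potential "\<lambda>z. V (expv z)" "\<lambda>z. f (expv z)" P q l "lnv ` C"
  proof
    fix z h :: "real ^ 'n" and t c :: real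
    show "((\<lambda>t. V (expv (z + t *\<^sub>R h))) has_real_derivative P (z + t *\<^sub>R h) h) (at t)"
      unfolding P_def by (rule DERIV_along_expv_curve[OF Vd])
    show "((\<lambda>t. f (expv (z + t *\<^sub>R h))) has_real_derivative l (z + t *\<^sub>R h) h) (at t)"
      unfolding l_def by (rule DERIV_along_expv_curve[OF fd])
    have "((\<lambda>t. \<Sum>i\<in>UNIV. partial i V (expv (z + t *\<^sub>R h)) * (expv (z + t *\<^sub>R h) $ i * h $ i))
        has_real_derivative q (z + t *\<^sub>R h) h) (at t)"
      unfolding q_def curvature_form[OF expv_orthant]
    proof (rule DERIV_sum)
      fix i
      let ?e = "expv (z + t *\<^sub>R h)"
      have "((\<lambda>t. expv (z + t *\<^sub>R h) $ i * h $ i) has_real_derivative (?e $ i * h $ i) * h $ i) (at t)"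
        by (rule DERIV_cmult_right[OF DERIV_expv_nth])
      from DERIV_mult'[OF DERIV_along_expv_curve[OF Vdd] this]
      show "((\<lambda>t. partial i V (expv (z + t *\<^sub>R h)) * (expv (z + t *\<^sub>R h) $ i * h $ i)) has_real_derivative
          (grad (partial i V) ?e \<bullet> scale_by ?e h) * (?e $ i * h $ i) + partial i V ?e * (?e $ i * h $ i * h $ i)) (at t)"
        by (simp add: add.commute)
    qed
    then show "((\<lambda>t. P (z + t *\<^sub>R h) h) has_real_derivative q (z + t *\<^sub>R h) h) (at t)"
      unfolding P_def grad_inner_scale_by .
    have e: "continuous_on UNIV (\<lambda>p :: (real ^ 'n) \<times> (real ^ 'n). expv (fst p) $ i * snd p $ i)" for i
      by (intro continuous_intros)
    have fe: "continuous_on UNIV (\<lambda>p :: (real ^ 'n) \<times> (real ^ 'n). F (expv (fst p)))"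
      if "continuous_on orthant F" for F :: "real ^ 'n \<Rightarrow> real"
      by (intro continuous_on_compose_expv that continuous_intros)
    show "continuous_on UNIV (\<lambda>(z, h). q z h)"
      unfolding q_def curvature_form[OF expv_orthant] grad_inner_scale_by case_prod_unfold
      by (intro continuous_on_sum continuous_on_add continuous_on_mult e fe Vddc Vdc
           continuous_on_component continuous_on_snd continuous_on_id)
    show "continuous_on UNIV (\<lambda>(z, h). l z h)"
      unfolding l_def grad_inner_scale_by case_prod_unfold
      by (intro continuous_on_sum continuous_on_mult e fe fdc)
    show "continuous_on UNIV (\<lambda>z. f (expv z))"
      by (intro continuous_on_compose_expv fc continuous_intros)
    show "q z (c *\<^sub>R h) = c\<^sup>2 * q z h"
      by (simp add: q_def scale_scale matrix_vector_mult_scaleR power2_eq_square)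
    show "l z (c *\<^sub>R h) = c * l z h"
      by (simp add: l_def scale_scale)
    show "0 < q z h" if "h \<noteq> 0"
    proof -
      have "scale_by (expv z) h \<noteq> 0" using that by (auto simp: scale_by_def vec_eq_iff expv_def)
      then show ?thesis using K[OF expv_orthant] unfolding q_def pos_def_def by blast
    qed
    show "compact (lnv ` C)"
      by (intro compact_continuous_image continuous_on_lnv C)
    show "f (expv z) = 0" if "z \<notin> lnv ` C"
    proof -
      have "expv z \<notin> C" using that lnv_expv[of z] by (metis imageI)
      then show ?thesis by (intro C) auto
    qed
  qed
  obtain \<epsilon>0 where \<epsilon>0: "\<epsilon>0 > 0" and *: "\<And>\<epsilon> z h. 0 < \<epsilon> \<Longrightarrow> \<epsilon> < \<epsilon>0 \<Longrightarrow>
    \<epsilon> / 2 * (f (expv (z + h)) - f (expv (z - h))) - ((V (expv (z + h)) + V (expv (z - h))) / 2 - V (expv z)) \<le> 0 \<or>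
    \<epsilon> / 2 * (f (expv (z + h)) - f (expv (z - h))) - ((V (expv (z + h)) + V (expv (z - h))) / 2 - V (expv z))
      \<le> \<epsilon>\<^sup>2 / 2 * (2 * l z (h /\<^sub>R \<epsilon>) - q z (h /\<^sub>R \<epsilon>) + \<eta>)"
    using perturbation_le_deficit[OF \<eta>] by blast
  show ?thesis
    unfolding Let_def
  proof (intro exI[of _ \<epsilon>0] conjI \<epsilon>0 allI impI)
    fix \<epsilon> :: real and x y :: "real ^ 'n"
    assume \<epsilon>: "0 < \<epsilon>" "\<epsilon> < \<epsilon>0" and xy: "x \<in> orthant" "y \<in> orthant"
    \<comment> \<open>Midpoint and half-difference in logarithmic coordinates, so that
      \<open>z + h\<close> and \<open>z - h\<close> represent \<open>x\<close> and \<open>y\<close>,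
      and \<open>expv z\<close> is their geometric mean.\<close>
    define z where "z = (1/2) *\<^sub>R (lnv x + lnv y)"
    define h where "h = (1/2) *\<^sub>R (lnv x - lnv y)"
    define m where "m = (\<chi> i. sqrt (x $ i * y $ i))"
    define Q where "Q = grad f m \<bullet> (matrix_inv (curvature V m) *v grad f m)"
    have zh: "z + h = lnv x" "z - h = lnv y"
      by (simp_all add: z_def h_def vec_eq_iff field_simps)
    have m: "expv z = m"
    proof (simp add: vec_eq_iff, intro allI)
      fix i
      have pos: "x $ i > 0" "y $ i > 0" using xy by (auto simp: orthant_def)
      have "exp ((ln (x $ i) + ln (y $ i)) / 2) = sqrt (x $ i * y $ i)"
        using pos by (intro real_sqrt_unique[symmetric]) (auto simp: power2_eq_square exp_add[of "ln _" "ln _"] simp flip: exp_add[of "_ / 2"])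
      then show "expv z $ i = m $ i"
        by (simp add: z_def m_def expv_def lnv_def)
    qed
    have Km: "pos_def (curvature V m)" unfolding m[symmetric] by (rule K) simp
    \<comment> \<open>Nonnegativity covers the first alternative of
      \<open>perturbation_le_deficit\<close>, where the left-hand side is at most 0.\<close>
    have "0 \<le> Q" unfolding Q_def using pos_def_young[OF Km, of "grad f m" 0] by simp
    moreover have "2 * l z k - q z k \<le> Q" for k
      unfolding Q_def l_def q_def m by (rule pos_def_young[OF Km])
    ultimately have "0 \<le> \<epsilon>\<^sup>2 / 2 * (Q + \<eta>)"
      and "\<epsilon>\<^sup>2 / 2 * (2 * l z (h /\<^sub>R \<epsilon>) - q z (h /\<^sub>R \<epsilon>) + \<eta>) \<le> \<epsilon>\<^sup>2 / 2 * (Q + \<eta>)"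
      using \<eta> by (auto intro!: mult_left_mono)
    with *[OF \<epsilon>, of z h]
    show "\<epsilon> / 2 * (f x - f y) - ((V x + V y) / 2 - V (\<chi> i. sqrt (x $ i * y $ i)))
       \<le> \<epsilon>\<^sup>2 / 2 * (grad f (\<chi> i. sqrt (x $ i * y $ i)) \<bullet> (matrix_inv (curvature V (\<chi> i. sqrt (x $ i * y $ i))) *v grad f (\<chi> i. sqrt (x $ i * y $ i))) + \<eta>)"
      unfolding m_def[symmetric] Q_def[symmetric] zh m expv_lnv[OF xy(1)] expv_lnv[OF xy(2)]
      by linarith
  qed
qed

section \<open>Small exponential moments and the variance\<close>

text \<open>The Lagrange remainder has the factor \<open>exp s / 6\<close>, which is at most
  \<open>3 / 6\<close> on the unit interval.\<close>

lemma exp_lower_bound: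
  fixes t :: real
  assumes "\<bar>t\<bar> \<le> 1"
  shows "1 + t + t\<^sup>2 / 2 - \<bar>t\<bar> ^ 3 \<le> exp t"
proof -
  obtain s where s: "\<bar>s\<bar> \<le> \<bar>t\<bar>" "exp t = (\<Sum>m<3. t ^ m / fact m) + exp s / fact 3 * t ^ 3"
    using Maclaurin_exp_le[of t 3] by blast
  have "exp s \<le> exp 1" using s assms by simp
  also have "exp 1 \<le> (3::real)" by (rule exp_le)
  finally have "exp s / 6 \<le> 1" by simp
  then have "exp s / 6 * \<bar>t\<bar> ^ 3 \<le> 1 * \<bar>t\<bar> ^ 3"
    by (intro mult_right_mono) auto
  moreover have "\<bar>exp s / 6 * t ^ 3\<bar> = exp s / 6 * \<bar>t\<bar> ^ 3"
    by (simp add: abs_mult power_abs)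
  ultimately have "- (\<bar>t\<bar> ^ 3) \<le> exp s / 6 * t ^ 3" by linarith
  then show ?thesis
    unfolding s(2) by (simp add: eval_nat_numeral fact_numeral)
qed

text \<open>Both sides are 1 up to order \<open>\<epsilon>\<^sup>2\<close>, since the terms with
  \<open>\<epsilon> * m\<close> cancel. Subtracting 1 and dividing by
  \<open>\<epsilon>\<^sup>2\<close> leaves \<open>s - m\<^sup>2\<close> and \<open>q\<close> in the
  limit, whatever \<open>C\<close> and \<open>D\<close> are.\<close>

lemma second_order_limit:
  fixes m s q C D :: real
  assumes "eventually (\<lambda>\<epsilon>. (1 + \<epsilon> * m + \<epsilon>\<^sup>2 / 2 * s - \<epsilon> ^ 3 * C) * (1 - \<epsilon> * m + \<epsilon>\<^sup>2 / 2 * s - \<epsilon> ^ 3 * C)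
     \<le> (1 + \<epsilon>\<^sup>2 / 2 * q + \<epsilon> ^ 4 * D)\<^sup>2) (at_right 0)"
  shows "s - m\<^sup>2 \<le> q"
proof (rule tendsto_le)
  show "((\<lambda>\<epsilon>. ((1 + \<epsilon> * m + \<epsilon>\<^sup>2 / 2 * s - \<epsilon> ^ 3 * C) * (1 - \<epsilon> * m + \<epsilon>\<^sup>2 / 2 * s - \<epsilon> ^ 3 * C) - 1) / \<epsilon>\<^sup>2) \<longlongrightarrow> s - m\<^sup>2) (at_right 0)"
  proof -
    have "((\<lambda>\<epsilon>. s - m\<^sup>2 - 2 * \<epsilon> * C + \<epsilon>\<^sup>2 * (s / 2 - \<epsilon> * C)\<^sup>2) \<longlongrightarrow> s - m\<^sup>2 - 2 * 0 * C + 0\<^sup>2 * (s / 2 - 0 * C)\<^sup>2) (at_right 0)"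
      by (intro tendsto_intros)
    then have "((\<lambda>\<epsilon>. s - m\<^sup>2 - 2 * \<epsilon> * C + \<epsilon>\<^sup>2 * (s / 2 - \<epsilon> * C)\<^sup>2) \<longlongrightarrow> s - m\<^sup>2) (at_right 0)"
      by simp
    moreover have "eventually (\<lambda>\<epsilon>. s - m\<^sup>2 - 2 * \<epsilon> * C + \<epsilon>\<^sup>2 * (s / 2 - \<epsilon> * C)\<^sup>2
      = ((1 + \<epsilon> * m + \<epsilon>\<^sup>2 / 2 * s - \<epsilon> ^ 3 * C) * (1 - \<epsilon> * m + \<epsilon>\<^sup>2 / 2 * s - \<epsilon> ^ 3 * C) - 1) / \<epsilon>\<^sup>2) (at_right 0)"
      using eventually_at_right_less[of 0]
      by eventually_elim (simp add: field_simps power2_eq_square eval_nat_numeral)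
    ultimately show ?thesis by (rule Lim_transform_eventually)
  qed
  show "((\<lambda>\<epsilon>. ((1 + \<epsilon>\<^sup>2 / 2 * q + \<epsilon> ^ 4 * D)\<^sup>2 - 1) / \<epsilon>\<^sup>2) \<longlongrightarrow> q) (at_right 0)"
  proof -
    have "((\<lambda>\<epsilon>. q + 2 * \<epsilon>\<^sup>2 * D + \<epsilon>\<^sup>2 * (q / 2 + \<epsilon>\<^sup>2 * D)\<^sup>2) \<longlongrightarrow> q + 2 * 0\<^sup>2 * D + 0\<^sup>2 * (q / 2 + 0\<^sup>2 * D)\<^sup>2) (at_right 0)"
      by (intro tendsto_intros)
    then have "((\<lambda>\<epsilon>. q + 2 * \<epsilon>\<^sup>2 * D + \<epsilon>\<^sup>2 * (q / 2 + \<epsilon>\<^sup>2 * D)\<^sup>2) \<longlongrightarrow> q) (at_right 0)"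
      by simp
    moreover have "eventually (\<lambda>\<epsilon>. q + 2 * \<epsilon>\<^sup>2 * D + \<epsilon>\<^sup>2 * (q / 2 + \<epsilon>\<^sup>2 * D)\<^sup>2
      = ((1 + \<epsilon>\<^sup>2 / 2 * q + \<epsilon> ^ 4 * D)\<^sup>2 - 1) / \<epsilon>\<^sup>2) (at_right 0)"
      using eventually_at_right_less[of 0]
      by eventually_elim (simp add: field_simps power2_eq_square eval_nat_numeral)
    ultimately show ?thesis by (rule Lim_transform_eventually)
  qed
  show "eventually (\<lambda>\<epsilon>. ((1 + \<epsilon> * m + \<epsilon>\<^sup>2 / 2 * s - \<epsilon> ^ 3 * C) * (1 - \<epsilon> * m + \<epsilon>\<^sup>2 / 2 * s - \<epsilon> ^ 3 * C) - 1) / \<epsilon>\<^sup>2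
     \<le> ((1 + \<epsilon>\<^sup>2 / 2 * q + \<epsilon> ^ 4 * D)\<^sup>2 - 1) / \<epsilon>\<^sup>2) (at_right 0)"
    using assms by eventually_elim (intro divide_right_mono, auto)
qed auto

text \<open>Boundedness of \<open>f\<close> and \<open>q\<close> makes the Taylor bounds for the
  exponentials uniform, so they can be integrated term by term and fed into
  \<open>second_order_limit\<close>.\<close>

lemma (in prob_space) variance_le_of_exponential_bound:
  fixes f q :: "'a \<Rightarrow> real"
  assumes [measurable]: "f \<in> borel_measurable M" "q \<in> borel_measurable M"
    and f: "\<And>x. x \<in> space M \<Longrightarrow> \<bar>f x\<bar> \<le> A" and q: "\<And>x. x \<in> space M \<Longrightarrow> 0 \<le> q x" "\<And>x. x \<in> space M \<Longrightarrow> q x \<le> A"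
    and bound: "eventually (\<lambda>\<epsilon>. expectation (\<lambda>x. exp (\<epsilon> * f x)) * expectation (\<lambda>x. exp (- \<epsilon> * f x))
        \<le> (expectation (\<lambda>x. exp (\<epsilon>\<^sup>2 / 2 * q x)))\<^sup>2) (at_right 0)"
  shows "variance f \<le> expectation q"
proof -
  have A: "A \<ge> 0" using f not_empty by fastforce
  have bdd: "integrable M h" if "h \<in> borel_measurable M" "\<And>x. x \<in> space M \<Longrightarrow> \<bar>h x\<bar> \<le> b" for h :: "'a \<Rightarrow> real" and b
    by (rule integrable_const_bound[of _ b]) (use that in auto)
  have f_int: "integrable M f" by (rule bdd[of _ A]) (use f in auto)
  have f2_int: "integrable M (\<lambda>x. (f x)\<^sup>2)"
    by (rule bdd[of _ "A\<^sup>2"]) (use f A in \<open>auto intro!: power2_le_iff_abs_le[THEN iffD2]\<close>)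
  have q_int: "integrable M q" by (rule bdd[of _ A]) (use q in auto)
  have q2_int: "integrable M (\<lambda>x. (q x)\<^sup>2)"
    by (rule bdd[of _ "A\<^sup>2"]) (use q A in \<open>auto intro!: power_mono\<close>)
  have lower: "1 + t * expectation f + t\<^sup>2 / 2 * expectation (\<lambda>x. (f x)\<^sup>2) - \<bar>t\<bar> ^ 3 * A ^ 3 \<le> expectation (\<lambda>x. exp (t * f x))"
    if t: "\<bar>t\<bar> * A \<le> 1" for t
  proof -
    have tf: "\<bar>t * f x\<bar> \<le> \<bar>t\<bar> * A" if "x \<in> space M" for x
      unfolding abs_mult using f[OF that] by (intro mult_left_mono) auto
    have "expectation (\<lambda>x. 1 + t * f x + t\<^sup>2 / 2 * (f x)\<^sup>2 - \<bar>t\<bar> ^ 3 * A ^ 3) \<le> expectation (\<lambda>x. exp (t * f x))"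
    proof (rule integral_mono)
      show "integrable M (\<lambda>x. exp (t * f x))"
        by (rule bdd[of _ "exp (\<bar>t\<bar> * A)"]) (use tf in \<open>force simp: abs_le_iff\<close>)+
      fix x assume x: "x \<in> space M"
      have "\<bar>t * f x\<bar> ^ 3 \<le> (\<bar>t\<bar> * A) ^ 3" by (intro power_mono tf x) auto
      then show "1 + t * f x + t\<^sup>2 / 2 * (f x)\<^sup>2 - \<bar>t\<bar> ^ 3 * A ^ 3 \<le> exp (t * f x)"
        using exp_lower_bound[of "t * f x"] order_trans[OF tf[OF x] t] by (simp add: power_mult_distrib)
    qed (auto simp: f_int f2_int)
    also have "expectation (\<lambda>x. 1 + t * f x + t\<^sup>2 / 2 * (f x)\<^sup>2 - \<bar>t\<bar> ^ 3 * A ^ 3)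
        = 1 + t * expectation f + t\<^sup>2 / 2 * expectation (\<lambda>x. (f x)\<^sup>2) - \<bar>t\<bar> ^ 3 * A ^ 3"
      using f_int f2_int by (simp add: prob_space)
    finally show ?thesis .
  qed
  have upper: "expectation (\<lambda>x. exp (t * q x)) \<le> 1 + t * expectation q + t\<^sup>2 * expectation (\<lambda>x. (q x)\<^sup>2)"
    if t: "0 \<le> t" "t * A \<le> 1" for t
  proof -
    have tq: "0 \<le> t * q x" "t * q x \<le> 1" if "x \<in> space M" for x
      using mult_left_mono[OF q(2)[OF that] t(1)] t q(1)[OF that] by auto
    have "expectation (\<lambda>x. exp (t * q x)) \<le> expectation (\<lambda>x. 1 + t * q x + t\<^sup>2 * (q x)\<^sup>2)"
    proof (rule integral_mono)
      show "integrable M (\<lambda>x. exp (t * q x))"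
        by (rule bdd[of _ "exp 1"]) (use tq in auto)
      fix x assume x: "x \<in> space M"
      show "exp (t * q x) \<le> 1 + t * q x + t\<^sup>2 * (q x)\<^sup>2"
        using exp_bound[OF tq[OF x]] by (simp add: power_mult_distrib)
    qed (auto simp: q_int q2_int)
    also have "\<dots> = 1 + t * expectation q + t\<^sup>2 * expectation (\<lambda>x. (q x)\<^sup>2)"
      using q_int q2_int by (simp add: prob_space)
    finally show ?thesis .
  qed
  have small: "eventually (\<lambda>\<epsilon>. 0 < \<epsilon> \<and> \<epsilon> * A \<le> 1 \<and> \<epsilon> < 1) (at_right 0)"
  proof -
    \<comment> \<open>\<open>A + 1\<close> keeps the denominator positive when
      \<open>A = 0\<close>.\<close>
    have "eventually (\<lambda>\<epsilon>. \<epsilon> < min 1 (1 / (A + 1))) (at_right (0::real))"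
      by (rule order_tendstoD(2)[OF tendsto_ident_at]) (use A in auto)
    then show ?thesis using eventually_at_right_less[of 0]
    proof eventually_elim
      case (elim \<epsilon>)
      then have "\<epsilon> * (A + 1) < 1" using A by (simp add: pos_less_divide_eq)
      with elim show ?case by (simp add: algebra_simps)
    qed
  qed
  let ?m = "expectation f" and ?s = "expectation (\<lambda>x. (f x)\<^sup>2)" and ?q = "expectation q"
  \<comment> \<open>The factor 4 comes from
    \<open>(\<epsilon>\<^sup>2 / 2)\<^sup>2 = \<epsilon> ^ 4 / 4\<close>.\<close>
  let ?D = "expectation (\<lambda>x. (q x)\<^sup>2) / 4"
  \<comment> \<open>Lower bounds can be multiplied only when they are nonnegative.\<close>
  have low0: "eventually (\<lambda>\<epsilon>. 0 \<le> 1 - \<epsilon> * ?m + \<epsilon>\<^sup>2 / 2 * ?s - \<epsilon> ^ 3 * A ^ 3 \<and> 0 \<le> 1 + \<epsilon> * ?m + \<epsilon>\<^sup>2 / 2 * ?s - \<epsilon> ^ 3 * A ^ 3) (at_right 0)"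
  proof -
    have "((\<lambda>\<epsilon>. 1 - \<epsilon> * ?m + \<epsilon>\<^sup>2 / 2 * ?s - \<epsilon> ^ 3 * A ^ 3) \<longlongrightarrow> 1 - 0 * ?m + 0\<^sup>2 / 2 * ?s - 0 ^ 3 * A ^ 3) (at_right 0)"
         "((\<lambda>\<epsilon>. 1 + \<epsilon> * ?m + \<epsilon>\<^sup>2 / 2 * ?s - \<epsilon> ^ 3 * A ^ 3) \<longlongrightarrow> 1 + 0 * ?m + 0\<^sup>2 / 2 * ?s - 0 ^ 3 * A ^ 3) (at_right 0)"
      by (intro tendsto_intros; simp)+
    then have "eventually (\<lambda>\<epsilon>. 0 < 1 - \<epsilon> * ?m + \<epsilon>\<^sup>2 / 2 * ?s - \<epsilon> ^ 3 * A ^ 3) (at_right 0)"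
        "eventually (\<lambda>\<epsilon>. 0 < 1 + \<epsilon> * ?m + \<epsilon>\<^sup>2 / 2 * ?s - \<epsilon> ^ 3 * A ^ 3) (at_right 0)"
      by (auto dest!: order_tendstoD(1)[where a=0])
    then show ?thesis by eventually_elim auto
  qed
  have "eventually (\<lambda>\<epsilon>. (1 + \<epsilon> * ?m + \<epsilon>\<^sup>2 / 2 * ?s - \<epsilon> ^ 3 * A ^ 3) * (1 - \<epsilon> * ?m + \<epsilon>\<^sup>2 / 2 * ?s - \<epsilon> ^ 3 * A ^ 3)
     \<le> (1 + \<epsilon>\<^sup>2 / 2 * ?q + \<epsilon> ^ 4 * ?D)\<^sup>2) (at_right 0)"
    using small bound low0
  proof eventually_elim
    case (elim \<epsilon>)
    have "(1 + \<epsilon> * ?m + \<epsilon>\<^sup>2 / 2 * ?s - \<epsilon> ^ 3 * A ^ 3) * (1 - \<epsilon> * ?m + \<epsilon>\<^sup>2 / 2 * ?s - \<epsilon> ^ 3 * A ^ 3)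
        \<le> expectation (\<lambda>x. exp (\<epsilon> * f x)) * expectation (\<lambda>x. exp (- \<epsilon> * f x))"
      using lower[of \<epsilon>] lower[of "-\<epsilon>"] elim by (intro mult_mono integral_nonneg_AE) auto
    also have "\<dots> \<le> (expectation (\<lambda>x. exp (\<epsilon>\<^sup>2 / 2 * q x)))\<^sup>2" using elim by simp
    also have "\<dots> \<le> (1 + \<epsilon>\<^sup>2 / 2 * ?q + (\<epsilon>\<^sup>2 / 2)\<^sup>2 * expectation (\<lambda>x. (q x)\<^sup>2))\<^sup>2"
    proof (intro power_mono upper integral_nonneg_AE)
      have "\<epsilon>\<^sup>2 / 2 * A = \<epsilon> / 2 * (\<epsilon> * A)" by (simp add: power2_eq_square)
      also have "\<dots> \<le> 1 * 1" using elim A by (intro mult_mono) auto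
      finally show "\<epsilon>\<^sup>2 / 2 * A \<le> 1" by simp
    qed auto
    also have "(\<epsilon>\<^sup>2 / 2)\<^sup>2 * expectation (\<lambda>x. (q x)\<^sup>2) = \<epsilon> ^ 4 * ?D"
      by (simp add: power2_eq_square eval_nat_numeral)
    finally show ?case .
  qed
  then have "?s - ?m\<^sup>2 \<le> ?q" by (rule second_order_limit)
  then show ?thesis using variance_eq[OF f_int f2_int] by simp
qed

section \<open>The Brascamp--Lieb inequality for the Gibbs measure\<close>

lemma continuous_on_curvature:
  fixes V :: "real ^ 'n \<Rightarrow> real"
  assumes "Ck_on (Suc (Suc 0)) orthant V"
  shows "continuous_on orthant (\<lambda>x. curvature V x $ i $ j)"
proof -
  have "continuous_on orthant (partial i (partial j V))"
    using assms by auto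
  moreover have "continuous_on orthant (partial i V)"
    using assms Ck_on_Suc[of 0 orthant "partial i V"] by auto
  moreover have "continuous_on orthant (\<lambda>x :: real ^ 'n. x $ i)"
    by (intro continuous_intros)
  ultimately have "continuous_on orthant (\<lambda>x. partial i (partial j V) x + (if i = j then partial i V x / x $ i else 0))"
    by (cases "i = j") (auto intro!: continuous_intros simp: orthant_def less_le)
  then show ?thesis
    by (simp add: curvature_def hess_def diag_mat_def cong: if_cong)
qed

lemma continuous_on_inv_curvature_form:
  fixes V f :: "real ^ 'n \<Rightarrow> real"
  assumes "Ck_on (Suc (Suc 0)) orthant V" and f: "Ck_on (Suc 0) orthant f"
    and K: "\<And>x. x \<in> orthant \<Longrightarrow> pos_def (curvature V x)"
  shows "continuous_on orthant (\<lambda>x. grad f x \<bullet> (matrix_inv (curvature V x) *v grad f x))"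
proof -
  have g: "continuous_on orthant (\<lambda>x. grad f x $ i)" for i
    using f by (simp add: grad_def)
  have "continuous_on orthant (grad f)"
    using f unfolding grad_def by (auto intro: continuous_on_vec_lambda)
  then show ?thesis
    by (intro continuous_on_inner continuous_on_matrix_inv_vector continuous_on_curvature g assms
          pos_def_invertible)
qed

lemma partial_eq_0_outside:
  fixes f :: "real ^ 'n \<Rightarrow> real"
  assumes "closed C" "\<And>x. x \<in> orthant - C \<Longrightarrow> f x = 0" "x \<in> orthant - C"
  shows "partial i f x = 0"
proof -
  have "(f has_derivative (\<lambda>_. 0)) (at x)"
    by (rule has_derivative_transform_within_open[of "\<lambda>_. 0" _ _ _ "orthant - C"])
       (use assms open_orthant in auto)
  then show ?thesis
    unfolding partial_def by (simp add: frechet_derivative_at[symmetric])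
qed

lemma bounded_of_compact_support:
  fixes h :: "real ^ 'n \<Rightarrow> real"
  assumes "continuous_on orthant h" "compact C" "C \<subseteq> orthant" "\<And>x. x \<in> orthant - C \<Longrightarrow> h x = 0"
  shows "\<exists>A. \<forall>x\<in>orthant. \<bar>h x\<bar> \<le> A"
proof -
  have "compact (h ` C)"
    by (intro compact_continuous_image continuous_on_subset[OF assms(1)] assms)
  then obtain A where "\<And>x. x \<in> C \<Longrightarrow> \<bar>h x\<bar> \<le> A" "A > 0"
    using bounded_pos[THEN iffD1, OF compact_imp_bounded] by force
  then have "\<bar>h x\<bar> \<le> A" if "x \<in> orthant" for x
    using assms(4)[of x] that by (cases "x \<in> C") auto
  then show ?thesis by blast
qed

lemma space_gibbs [simp]: "space (gibbs V) = orthant"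
  by (simp add: gibbs_def space_restrict_space)

lemma borel_measurable_gibbs:
  fixes h :: "real ^ 'n \<Rightarrow> real"
  assumes "continuous_on orthant h"
  shows "h \<in> borel_measurable (gibbs V)"
proof -
  have "sets (gibbs V) = sets (restrict_space borel orthant)"
    unfolding gibbs_def sets_density by (rule sets_restrict_space_cong) simp
  then show ?thesis
    using borel_measurable_continuous_on_restrict[OF assms] measurable_cong_sets by blast
qed

lemma orthant_borel [measurable]: "orthant \<in> sets borel"
  by (rule borel_open[OF open_orthant])

lemma borel_measurable_indicator_orthant:
  fixes h :: "real ^ 'n \<Rightarrow> real"
  assumes "continuous_on orthant h"
  shows "(\<lambda>x. ennreal (h x) * indicator orthant x) \<in> borel_measurable borel"
proof -
  have "(\<lambda>x. ennreal (h x)) \<in> borel_measurable (restrict_space borel orthant)"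
    using borel_measurable_continuous_on_restrict[OF assms] by simp
  then show ?thesis
    by (subst (asm) borel_measurable_restrict_space_iff_ennreal) auto
qed

text \<open>Prekopa--Leindler with the weight \<open>exp (- V)\<close>: the normalising constant
  enters both sides as \<open>1 / Z\<^sup>2\<close>, and every density is extended by 0 outside the
  orthant.\<close>

lemma gibbs_exp_moment:
  fixes V a b c :: "real ^ 'n \<Rightarrow> real"
  assumes prob: "prob_space (gibbs V)" and V: "continuous_on orthant V"
    and cont: "continuous_on orthant a" "continuous_on orthant b" "continuous_on orthant c"
    and int: "integrable (gibbs V) (\<lambda>x. exp (a x))" "integrable (gibbs V) (\<lambda>x. exp (b x))"
      "integrable (gibbs V) (\<lambda>x. exp (c x))"
    and le: "\<And>x y. x \<in> orthant \<Longrightarrow> y \<in> orthant \<Longrightarrow>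
      (a x - V x) + (b y - V y) \<le> 2 * (c (\<chi> i. sqrt (x $ i * y $ i)) - V (\<chi> i. sqrt (x $ i * y $ i)))"
  shows "(\<integral>x. exp (a x) \<partial>gibbs V) * (\<integral>x. exp (b x) \<partial>gibbs V) \<le> (\<integral>x. exp (c x) \<partial>gibbs V)\<^sup>2"
proof -
  define Z where "Z = (\<integral>y. exp (- V y) \<partial>restrict_space lborel orthant)"
  have gibbs: "gibbs V = density (restrict_space lborel orthant) (\<lambda>x. ennreal (exp (- V x) / Z))"
    by (simp add: gibbs_def Z_def)
  have "Z \<ge> 0" unfolding Z_def by (intro integral_nonneg_AE) auto
  \<comment> \<open>Division by 0 yields 0, so \<open>Z = 0\<close> would make the Gibbs measure
    null.\<close>
  moreover have "Z \<noteq> 0"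
  proof
    assume "Z = 0"
    then have "emeasure (gibbs V) (space (gibbs V)) = 0"
      unfolding gibbs by (subst emeasure_density) (auto simp: sets_restrict_space_iff)
    with prob_space.emeasure_space_1[OF prob] show False by simp
  qed
  ultimately have Z: "Z > 0" by simp
  have dens: "exp (h x) * (exp (- V x) / Z) = exp (h x - V x) / Z" for h x
    by (simp add: exp_diff exp_minus field_simps)
  have cont_dens: "continuous_on orthant (\<lambda>x. exp (h x - V x) / Z)" if "continuous_on orthant h" for h
    using Z by (intro continuous_intros that V) auto
  have eq: "ennreal (\<integral>x. exp (h x) \<partial>gibbs V) = (\<integral>\<^sup>+x. ennreal (exp (h x - V x) / Z) * indicator orthant x \<partial>lborel)"
    if h: "continuous_on orthant h" "integrable (gibbs V) (\<lambda>x. exp (h x))" for h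
  proof -
    have m: "g \<in> borel_measurable (restrict_space lborel orthant)" if "continuous_on orthant g" for g :: "real ^ 'n \<Rightarrow> real"
      using borel_measurable_gibbs[OF that, of V] by (simp add: gibbs)
    have "ennreal (\<integral>x. exp (h x) \<partial>gibbs V) = (\<integral>\<^sup>+x. ennreal (exp (h x)) \<partial>gibbs V)"
      by (rule nn_integral_eq_integral[symmetric]) (use h in auto)
    also have "\<dots> = (\<integral>\<^sup>+x. ennreal (exp (- V x) / Z) * ennreal (exp (h x)) \<partial>restrict_space lborel orthant)"
      unfolding gibbs
      by (rule nn_integral_density)
         (use Z in \<open>auto intro!: measurable_compose[OF _ measurable_ennreal] m continuous_intros h V\<close>)
    also have "\<dots> = (\<integral>\<^sup>+x. ennreal (exp (h x - V x) / Z) \<partial>restrict_space lborel orthant)"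
      using Z by (simp add: ennreal_mult[symmetric] dens[symmetric] mult.commute)
    also have "\<dots> = (\<integral>\<^sup>+x. ennreal (exp (h x - V x) / Z) * indicator orthant x \<partial>lborel)"
      by (rule nn_integral_restrict_space) auto
    finally show ?thesis .
  qed
  have "ennreal (\<integral>x. exp (a x) \<partial>gibbs V) * ennreal (\<integral>x. exp (b x) \<partial>gibbs V) \<le> (ennreal (\<integral>x. exp (c x) \<partial>gibbs V))\<^sup>2"
    unfolding eq[OF cont(1) int(1)] eq[OF cont(2) int(2)] eq[OF cont(3) int(3)]
  proof (rule prekopa_leindler_orthant)
    fix x y :: "real ^ 'n" assume xy: "x \<in> orthant" "y \<in> orthant"
    define m where "m = (\<chi> i. sqrt (x $ i * y $ i))"
    have m: "m \<in> orthant" using xy by (auto simp: m_def orthant_def)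
    have "exp (a x - V x) / Z * (exp (b y - V y) / Z) = exp ((a x - V x) + (b y - V y)) / Z\<^sup>2"
      by (simp add: exp_add power2_eq_square)
    also have "\<dots> \<le> exp (2 * (c m - V m)) / Z\<^sup>2"
      using le[OF xy] Z by (intro divide_right_mono) (auto simp: m_def)
    also have "\<dots> = (exp (c m - V m) / Z)\<^sup>2"
      using exp_double[of "c m - V m"] by (simp add: power_divide)
    finally have "ennreal (exp (a x - V x) / Z * (exp (b y - V y) / Z)) \<le> ennreal ((exp (c m - V m) / Z)\<^sup>2)"
      by (rule ennreal_leI)
    moreover have "ennreal (exp (a x - V x) / Z * (exp (b y - V y) / Z))
        = ennreal (exp (a x - V x) / Z) * ennreal (exp (b y - V y) / Z)"
      using Z by (intro ennreal_mult) auto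
    moreover have "ennreal ((exp (c m - V m) / Z)\<^sup>2) = (ennreal (exp (c m - V m) / Z))\<^sup>2"
      using Z by (intro ennreal_power[symmetric]) auto
    ultimately show "ennreal (exp (a x - V x) / Z) * indicator orthant x * (ennreal (exp (b y - V y) / Z) * indicator orthant y)
        \<le> (ennreal (exp (c (\<chi> i. sqrt (x $ i * y $ i)) - V (\<chi> i. sqrt (x $ i * y $ i))) / Z) * indicator orthant (\<chi> i. sqrt (x $ i * y $ i)))\<^sup>2"
      using xy m by (simp add: m_def[symmetric])
  qed (auto intro!: borel_measurable_indicator_orthant cont_dens cont)
  then show ?thesis
    by (simp add: ennreal_mult[symmetric] ennreal_power ennreal_le_iff)
qed

text \<open>Integrability is stated as well because comparing this expectation with a larger one
  needs it: the integral of a non-integrable function is 0 by convention.\<close>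

lemma brascamp_lieb_orthant:
  fixes V f :: "real ^ 'n \<Rightarrow> real"
  assumes V: "Ck_on (Suc (Suc 0)) orthant V" and prob: "prob_space (gibbs V)"
    and f: "Ck_on (Suc 0) orthant f"
    and C: "compact C" "C \<subseteq> orthant" "\<And>x. x \<in> orthant - C \<Longrightarrow> f x = 0"
    and K: "\<And>x. x \<in> orthant \<Longrightarrow> pos_def (curvature V x)"
  shows "integrable (gibbs V) (\<lambda>x. grad f x \<bullet> (matrix_inv (curvature V x) *v grad f x))"
    and "prob_space.variance (gibbs V) f
      \<le> prob_space.expectation (gibbs V) (\<lambda>x. grad f x \<bullet> (matrix_inv (curvature V x) *v grad f x))"
proof -
  interpret prob_space "gibbs V" by (rule prob)
  define Q where "Q x = grad f x \<bullet> (matrix_inv (curvature V x) *v grad f x)" for x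
  have Vc: "continuous_on orthant V" and fc: "continuous_on orthant f"
    using Ck_on_Suc[OF Ck_on_Suc[OF V]] Ck_on_Suc[OF f] by auto
  have Qc: "continuous_on orthant Q"
    unfolding Q_def by (rule continuous_on_inv_curvature_form[OF V f K])
  have Q0: "0 \<le> Q x" if "x \<in> orthant" for x
    using pos_def_young[OF K[OF that], of "grad f x" 0] by (simp add: Q_def)
  \<comment> \<open>The gradient of \<open>f\<close> vanishes off \<open>C\<close>, so the
    continuous function \<open>Q\<close> is bounded, however \<open>K\<close> degenerates near the
    boundary or at infinity.\<close>
  have "Q x = 0" if "x \<in> orthant - C" for x
    using partial_eq_0_outside[OF compact_imp_closed[OF C(1)] C(3) that] by (simp add: Q_def inner_vec_def grad_def)
  then obtain A1 where A1: "\<And>x. x \<in> orthant \<Longrightarrow> \<bar>Q x\<bar> \<le> A1"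
    using bounded_of_compact_support[OF Qc C(1,2)] by blast
  obtain A2 where A2: "\<And>x. x \<in> orthant \<Longrightarrow> \<bar>f x\<bar> \<le> A2"
    using bounded_of_compact_support[OF fc C] by blast
  have bdd_int: "integrable (gibbs V) h" if "continuous_on orthant h" "\<And>x. x \<in> orthant \<Longrightarrow> \<bar>h x\<bar> \<le> b" for h :: "real ^ 'n \<Rightarrow> real" and b
    by (rule integrable_const_bound[of _ b]) (use that borel_measurable_gibbs in auto)
  have exp_int: "integrable (gibbs V) (\<lambda>x. exp (h x))" if "continuous_on orthant h" "\<And>x. x \<in> orthant \<Longrightarrow> h x \<le> b" for h :: "real ^ 'n \<Rightarrow> real" and b
    by (rule bdd_int[of _ "exp b"]) (use that in \<open>auto intro!: continuous_intros\<close>)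
  have Q_int: "integrable (gibbs V) Q"
    by (rule bdd_int[OF Qc A1])
  \<comment> \<open>\<open>\<eta>\<close> stays fixed while \<open>\<epsilon>\<close> tends to 0,
    since the admissible range of \<open>\<epsilon>\<close> depends on it.\<close>
  have "variance f \<le> expectation Q + \<eta>" if \<eta>: "\<eta> > 0" for \<eta>
  proof -
    have "\<exists>\<epsilon>0>0. \<forall>\<epsilon> x y. 0 < \<epsilon> \<longrightarrow> \<epsilon> < \<epsilon>0 \<longrightarrow> x \<in> orthant \<longrightarrow> y \<in> orthant \<longrightarrow>
       \<epsilon> / 2 * (f x - f y) - ((V x + V y) / 2 - V (\<chi> i. sqrt (x $ i * y $ i)))
        \<le> \<epsilon>\<^sup>2 / 2 * (Q (\<chi> i. sqrt (x $ i * y $ i)) + \<eta>)"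
      unfolding Q_def
      by (rule pointwise_infimal_convolution[unfolded Let_def, OF V f C(1,2) _ _ \<eta>]) (fact C K)+
    then obtain \<epsilon>0 where \<epsilon>0: "\<epsilon>0 > 0" and pw: "\<forall>\<epsilon> x y. 0 < \<epsilon> \<longrightarrow> \<epsilon> < \<epsilon>0 \<longrightarrow> x \<in> orthant \<longrightarrow> y \<in> orthant \<longrightarrow>
       \<epsilon> / 2 * (f x - f y) - ((V x + V y) / 2 - V (\<chi> i. sqrt (x $ i * y $ i)))
        \<le> \<epsilon>\<^sup>2 / 2 * (Q (\<chi> i. sqrt (x $ i * y $ i)) + \<eta>)"
      by (elim exE conjE)
    note pw = pw[rule_format]
    have "variance f \<le> expectation (\<lambda>x. Q x + \<eta>)"
    proof (rule variance_le_of_exponential_bound[where A="max A2 (A1 + \<eta>)"])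
      have "eventually (\<lambda>\<epsilon>. 0 < \<epsilon> \<and> \<epsilon> < \<epsilon>0) (at_right 0)"
        using eventually_at_right_less[of 0] order_tendstoD(2)[OF tendsto_ident_at \<epsilon>0]
        by eventually_elim auto
      then show "eventually (\<lambda>\<epsilon>. expectation (\<lambda>x. exp (\<epsilon> * f x)) * expectation (\<lambda>x. exp (- \<epsilon> * f x))
        \<le> (expectation (\<lambda>x. exp (\<epsilon>\<^sup>2 / 2 * (Q x + \<eta>))))\<^sup>2) (at_right 0)"
      proof eventually_elim
        case (elim \<epsilon>)
        show ?case
        proof (rule gibbs_exp_moment[OF prob Vc])
          have le: "\<epsilon> * f x \<le> \<epsilon> * A2" "- \<epsilon> * f x \<le> \<epsilon> * A2" if "x \<in> orthant" for x
            using A2[OF that] elim mult_left_mono[of "f x" A2 \<epsilon>] mult_left_mono[of "- f x" A2 \<epsilon>]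
            by auto
          show "integrable (gibbs V) (\<lambda>x. exp (\<epsilon> * f x))"
            by (rule exp_int[OF _ le(1)]) (intro continuous_intros fc)
          show "integrable (gibbs V) (\<lambda>x. exp (- \<epsilon> * f x))"
            by (rule exp_int[OF _ le(2)]) (intro continuous_intros fc)
          show "integrable (gibbs V) (\<lambda>x. exp (\<epsilon>\<^sup>2 / 2 * (Q x + \<eta>)))"
          proof (rule exp_int)
            show "\<epsilon>\<^sup>2 / 2 * (Q x + \<eta>) \<le> \<epsilon>\<^sup>2 / 2 * (A1 + \<eta>)" if "x \<in> orthant" for x
              using A1[OF that] by (intro mult_left_mono) auto
          qed (intro continuous_intros Qc)
          fix x y :: "real ^ 'n" assume xy: "x \<in> orthant" "y \<in> orthant"
          define m where "m = (\<chi> i. sqrt (x $ i * y $ i))"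
          \<comment> \<open>Doubling the pointwise bound gives the form required by
            \<open>gibbs_exp_moment\<close>.\<close>
          have "2 * (\<epsilon> / 2 * (f x - f y) - ((V x + V y) / 2 - V m)) \<le> 2 * (\<epsilon>\<^sup>2 / 2 * (Q m + \<eta>))"
            using pw[of \<epsilon>, OF _ _ xy] elim unfolding m_def by (intro mult_left_mono) auto
          moreover have "2 * (\<epsilon> / 2 * (f x - f y) - ((V x + V y) / 2 - V m))
              = (\<epsilon> * f x - V x) + (- \<epsilon> * f y - V y) + 2 * V m"
            by (simp add: field_simps)
          ultimately show "(\<epsilon> * f x - V x) + (- \<epsilon> * f y - V y)
              \<le> 2 * (\<epsilon>\<^sup>2 / 2 * (Q (\<chi> i. sqrt (x $ i * y $ i)) + \<eta>) - V (\<chi> i. sqrt (x $ i * y $ i)))"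
            unfolding m_def[symmetric] by simp
        qed (intro continuous_intros fc Qc; simp)+
      qed
    next
      fix x assume "x \<in> space (gibbs V)"
      then have x: "x \<in> orthant" by simp
      show "\<bar>f x\<bar> \<le> max A2 (A1 + \<eta>)" "0 \<le> Q x + \<eta>" "Q x + \<eta> \<le> max A2 (A1 + \<eta>)"
        using A1[OF x] A2[OF x] Q0[OF x] \<eta> by auto
    qed (auto intro!: borel_measurable_gibbs continuous_intros fc Qc)
    also have "\<dots> = expectation Q + \<eta>"
      using Q_int prob_space by simp
    finally show ?thesis .
  qed
  then have "variance f \<le> expectation Q" by (rule field_le_epsilon)
  then show "variance f \<le> expectation (\<lambda>x. grad f x \<bullet> (matrix_inv (curvature V x) *v grad f x))"
    and "integrable (gibbs V) (\<lambda>x. grad f x \<bullet> (matrix_inv (curvature V x) *v grad f x))"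
    using Q_int unfolding Q_def .
qed

section \<open>From the ULC condition to the weighted Poincare inequality\<close>

lemma inner_diag_mat: "v \<bullet> (diag_mat d *v v) = (\<Sum>i\<in>UNIV. d $ i * (v $ i)\<^sup>2)"
proof -
  have "(\<Sum>j\<in>UNIV. (if i = j then d $ i else 0) * v $ j) = d $ i * v $ i" for i
  proof -
    have "(if i = j then d $ i else 0) * v $ j = (if i = j then d $ i * v $ j else 0)" for j by simp
    then show ?thesis by simp
  qed
  then show ?thesis
    by (simp add: inner_vec_def matrix_vector_mult_def diag_mat_def power2_eq_square mult_ac cong: if_cong)
qed

lemma ulc_form_le:
  assumes "laguerre_ulc \<kappa> V" "x \<in> orthant"
  shows "\<kappa> * (\<Sum>i\<in>UNIV. (v $ i)\<^sup>2 / x $ i) \<le> v \<bullet> (curvature V x *v v)"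
proof -
  have "0 \<le> v \<bullet> ((curvature V x - \<kappa> *\<^sub>R diag_mat (\<chi> i. 1 / x $ i)) *v v)"
    using assms by (auto simp: laguerre_ulc_def pos_semidef_def)
  also have "\<dots> = v \<bullet> (curvature V x *v v) - \<kappa> * (v \<bullet> (diag_mat (\<chi> i. 1 / x $ i) *v v))"
    by (simp add: matrix_vector_mult_diff_rdistrib inner_diff_right flip: scaleR_matrix_vector_assoc)
  finally show ?thesis by (simp add: inner_diag_mat)
qed

lemma ulc_pos_def:
  assumes "laguerre_ulc \<kappa> V" "x \<in> orthant"
  shows "pos_def (curvature V x)"
  unfolding pos_def_def
proof (intro conjI allI impI)
  define D where "D = \<kappa> *\<^sub>R diag_mat (\<chi> i. 1 / x $ i)"
  have "transpose (curvature V x - D) = curvature V x - D"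
    using assms by (auto simp: laguerre_ulc_def pos_semidef_def D_def)
  moreover have "transpose D = D"
    by (auto simp: D_def transpose_def diag_mat_def vec_eq_iff)
  ultimately show "transpose (curvature V x) = curvature V x"
    by (simp add: transpose_def vec_eq_iff)
  fix v :: "real ^ 'a" assume "v \<noteq> 0"
  then obtain i where i: "v $ i \<noteq> 0" by (auto simp: vec_eq_iff)
  have x: "0 < x $ j" for j using assms by (simp add: orthant_def)
  have "0 < (\<Sum>i\<in>UNIV. (v $ i)\<^sup>2 / x $ i)"
    by (rule sum_pos2[of _ i]) (use i x in \<open>auto simp: less_imp_le\<close>)
  then have "0 < \<kappa> * (\<Sum>i\<in>UNIV. (v $ i)\<^sup>2 / x $ i)"
    using assms by (simp add: laguerre_ulc_def)
  also note ulc_form_le[OF assms]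
  finally show "0 < v \<bullet> (curvature V x *v v)" .
qed

text \<open>Inversion reverses the order of positive definite matrices. Here this is proved by
  testing the ULC bound at the single vector \<open>w = matrix_inv (curvature V x) *v b\<close> and
  completing the square in each coordinate.\<close>

lemma ulc_inverse_form_le:
  assumes "laguerre_ulc \<kappa> V" "x \<in> orthant"
  shows "\<kappa> * (b \<bullet> (matrix_inv (curvature V x) *v b)) \<le> (\<Sum>i\<in>UNIV. x $ i * (b $ i)\<^sup>2)"
proof -
  define w where "w = matrix_inv (curvature V x) *v b"
  have Kw: "curvature V x *v w = b"
    unfolding w_def by (intro matrix_inv_vector_mult pos_def_invertible ulc_pos_def[OF assms])
  have \<kappa>: "\<kappa> > 0" using assms by (simp add: laguerre_ulc_def)
  \<comment> \<open>Since \<open>K w = b\<close>, the forms \<open>b \<bullet> w\<close> and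
    \<open>w \<bullet> K w\<close> agree; writing one as twice itself minus the other brings in a
    term with a negative sign, to which the ULC bound applies.\<close>
  have "\<kappa> * (b \<bullet> w) = 2 * (\<kappa> * (b \<bullet> w)) - \<kappa> * (w \<bullet> (curvature V x *v w))"
    by (simp add: Kw inner_commute)
  also have "\<dots> \<le> 2 * (\<kappa> * (b \<bullet> w)) - \<kappa> * (\<kappa> * (\<Sum>i\<in>UNIV. (w $ i)\<^sup>2 / x $ i))"
    using ulc_form_le[OF assms, of w] \<kappa> by simp
  also have "\<dots> = (\<Sum>i\<in>UNIV. 2 * \<kappa> * (b $ i * w $ i) - \<kappa>\<^sup>2 * ((w $ i)\<^sup>2 / x $ i))"
    by (simp add: inner_vec_def sum_subtractf sum_distrib_left power2_eq_square mult.assoc)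
  also have "\<dots> \<le> (\<Sum>i\<in>UNIV. x $ i * (b $ i)\<^sup>2)"
  proof (rule sum_mono)
    fix i
    have x: "0 < x $ i" using assms by (simp add: orthant_def)
    have "0 \<le> (x $ i * b $ i - \<kappa> * w $ i)\<^sup>2 / x $ i" using x by simp
    also have "\<dots> = x $ i * (b $ i)\<^sup>2 - (2 * \<kappa> * (b $ i * w $ i) - \<kappa>\<^sup>2 * ((w $ i)\<^sup>2 / x $ i))"
      using x by (simp add: field_simps power2_eq_square)
    finally show "2 * \<kappa> * (b $ i * w $ i) - \<kappa>\<^sup>2 * ((w $ i)\<^sup>2 / x $ i) \<le> x $ i * (b $ i)\<^sup>2" by simp
  qed
  finally show ?thesis by (simp add: w_def)
qed

lemma brascamp_lieb_ulc:
  fixes V f :: "real ^ 'n \<Rightarrow> real"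
  assumes V: "Ck_on (Suc (Suc 0)) orthant V" and prob: "prob_space (gibbs V)"
    and f: "Ck_on (Suc 0) orthant f"
    and C: "compact C" "C \<subseteq> orthant" "\<And>x. x \<in> orthant - C \<Longrightarrow> f x = 0"
    and ulc: "laguerre_ulc \<kappa> V"
  shows "\<kappa> * prob_space.variance (gibbs V) f
    \<le> prob_space.expectation (gibbs V) (\<lambda>x. \<Sum>i\<in>UNIV. x $ i * (partial i f x)\<^sup>2)"
proof -
  interpret prob_space "gibbs V" by (rule prob)
  let ?Q = "\<lambda>x. grad f x \<bullet> (matrix_inv (curvature V x) *v grad f x)"
  let ?E = "\<lambda>x. \<Sum>i\<in>UNIV. x $ i * (partial i f x)\<^sup>2"
  note BL = brascamp_lieb_orthant[OF V prob f C ulc_pos_def[OF ulc]]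
  have Ec: "continuous_on orthant ?E"
    using f by (intro continuous_intros) auto
  have "?E x = 0" if "x \<in> orthant - C" for x
    using partial_eq_0_outside[OF compact_imp_closed[OF C(1)] C(3) that] by simp
  then obtain A where "\<And>x. x \<in> orthant \<Longrightarrow> \<bar>?E x\<bar> \<le> A"
    using bounded_of_compact_support[OF Ec C(1,2)] by blast
  then have E_int: "integrable (gibbs V) ?E"
    by (intro integrable_const_bound[of _ A] borel_measurable_gibbs Ec) auto
  have "\<kappa> * variance f \<le> \<kappa> * expectation ?Q"
    using BL(2) ulc by (intro mult_left_mono) (auto simp: laguerre_ulc_def)
  also have "\<dots> = expectation (\<lambda>x. \<kappa> * ?Q x)" by simp
  also have "\<dots> \<le> expectation ?E"
  proof (rule integral_mono)
    fix x assume "x \<in> space (gibbs V)"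
    then show "\<kappa> * ?Q x \<le> ?E x"
      using ulc_inverse_form_le[OF ulc, of x "grad f x"] by (simp add: grad_def)
  qed (use BL(1) E_int in auto)
  finally show ?thesis .
qed

theorem theorem7p1:
  fixes V :: "real ^ 'n \<Rightarrow> real"
    and M :: "'w measure"
    and F :: "real \<Rightarrow> 'w measure"
    and B :: "real \<Rightarrow> 'w \<Rightarrow> real ^ 'n"
  assumes "Ck_on 3 orthant V"
    and "prob_space (gibbs V)"
    and "filtered_prob_space M F"
    and "std_brownian_motion M F B"
    and "laguerre_well_posed V M F B"
  shows "(\<forall>\<kappa>>0. laguerre_ulc \<kappa> V \<longrightarrow>
            (\<forall>f. test_function f \<longrightarrow>
               \<kappa> * prob_space.variance (gibbs V) f
                 \<le> prob_space.expectation (gibbs V) (\<lambda>x. \<Sum>i\<in>UNIV. x $ i * (partial i f x)\<^sup>2)))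
       \<and> ((\<forall>x\<in>orthant. pos_def (curvature V x)) \<longrightarrow>
            (\<forall>f. test_function f \<longrightarrow>
               prob_space.variance (gibbs V) f
                 \<le> prob_space.expectation (gibbs V)
                     (\<lambda>x. grad f x \<bullet> (matrix_inv (curvature V x) *v grad f x))))"
proof -
  have V: "Ck_on (Suc (Suc 0)) orthant V"
    by (rule Ck_on_Suc) (use assms(1) in \<open>simp only: numeral_3_eq_3\<close>)
  show ?thesis
  proof (intro conjI allI impI)
    fix \<kappa> :: real and f :: "real ^ 'n \<Rightarrow> real"
    assume ulc: "laguerre_ulc \<kappa> V" and "test_function f"
    then obtain C where "compact C" "C \<subseteq> orthant" "\<And>x. x \<in> orthant - C \<Longrightarrow> f x = 0" "Ck_on (Suc 0) orthant f"
      unfolding test_function_def by blast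
    then show "\<kappa> * prob_space.variance (gibbs V) f
        \<le> prob_space.expectation (gibbs V) (\<lambda>x. \<Sum>i\<in>UNIV. x $ i * (partial i f x)\<^sup>2)"
      by (intro brascamp_lieb_ulc[OF V assms(2)] ulc)
  next
    fix f :: "real ^ 'n \<Rightarrow> real"
    assume K: "\<forall>x\<in>orthant. pos_def (curvature V x)" and "test_function f"
    then obtain C where "compact C" "C \<subseteq> orthant" "\<And>x. x \<in> orthant - C \<Longrightarrow> f x = 0" "Ck_on (Suc 0) orthant f"
      unfolding test_function_def by blast
    then show "prob_space.variance (gibbs V) f
        \<le> prob_space.expectation (gibbs V) (\<lambda>x. grad f x \<bullet> (matrix_inv (curvature V x) *v grad f x))"
      using K by (intro brascamp_lieb_orthant(2)[OF V assms(2)]) auto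
  qed
qed

end
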